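(* Suppose that $S$ restricts to a $C_0$-semigroup $S_H$ on $H$. Then for all $1<p<\infty$ there exists a constant $C\ge 0$ such that for all $t>0$, all $f\in\mathscr{F}C_{\rm b}^{1,0}(E)$ and all $x\in E$ we have $$\sqrt{t}\,|D_H P(t)f(x)| \le C\,\kappa(t)\,\big(P(t)|f|^p(x)\big)^{1/p},$$ where $\kappa(t):=\sup_{s\in[0,t]}\|S_H(s)\|_{\mathscr{L}(H)}$ and $|\cdot|$ on the left-hand side denotes the norm of $H$.
   Context: Setting. $E$ is a real Banach space, $A$ is the generator of a $C_0$-semigroup $S=(S(t))_{t\ge0}$ on $E$, and $H$ is a real Hilbert space continuously embedded in $E$ with inclusion map $i:H\hookrightarrow E$. The semigroup $S$ restricts to a $C_0$-semigroup on $H$ if there is a $C_0$-semigroup $S_H$ on $H$ with $S(t)\circ i=i\circ S_H(t)$ for all $t\ge0$. Standing assumption: the operator $I_\infty:L^2(0,\infty;H)\to E$, $I_\infty g:=\int_0^\infty S(t)i g(t)\,dt$, is $\gamma$-radonifying; equivalently, $I_\infty I_\infty^*$ is the covariance operator of a centred Gaussian Radon measure $\mu_\infty$ on $E$. Then for each $t\ge0$ the operator $I_t:L^2(0,t;H)\to E$, $I_tg:=\int_0^tS(s)ig(s)\,ds$, is also $\gamma$-radonifying, and $I_tI_t^*$ is the covariance operator of a centred Gaussian Radon measure $\mu_t$ on $E$. With $W_H$ an $H$-cylindrical Brownian motion, $\mu_t$ is the distribution of $\int_0^tS(t-s)i\,dW_H(s)$, and $U^x(t)=S(t)x+\int_0^tS(t-s)i\,dW_H(s)$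 is the solution of $dU(t)=AU(t)\,dt+dW_H(t)$, $U(0)=x$. The Ornstein-Uhlenbeck semigroup $P=(P(t))_{t\ge0}$ is defined for bounded continuous $f:E\to\mathbb{R}$ by $P(t)f(x)=\mathbb{E}f(U^x(t))=\int_Ef(S(t)x+y)\,d\mu_t(y)$. For integers $k,l\ge0$, $\mathscr{F}C_{\rm b}^{k,l}(E)$ is the space of all $f\in C_{\rm b}(E)$ of the form $f(x)=\varphi(\langle x,x_1^*\rangle,\dots,\langle x,x_N^*\rangle)$ with $N\ge1$, $\varphi\in C_{\rm b}^k(\mathbb{R}^N)$ ($k$ times continuously differentiable, bounded with bounded derivatives up to order $k$) and $x_1^*,\dots,x_N^*\in\mathsf{D}(A^{*l})$ (all of $E^*$ if $l=0$). For such $f$ with $k\ge1$, $$D_Hf(x)=\sum_{n=1}^N\frac{\partial\varphi}{\partial x_n}(\langle x,x_1^*\rangle,\dots,\langle x,x_N^*\rangle)\,i^*x_n^*\in H,$$ the Fréchet derivative in the directions of $H$ (where $H$ is identified with its dual). For $f\in\mathscr{F}C_{\rm b}^{1,0}(E)$ one has $P(t)f\in\mathscr{F}C_{\rm b}^{1,0}(E)$, so $D_HP(t)f(x)$ is well defined. *)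

theory Defs
  imports "HOL-Probability.Probability"
begin

section \<open>Semigroups and the embedding\<close>

definition C0_semigroup :: "(real \<Rightarrow> 'a::banach \<Rightarrow>\<^sub>L 'a) \<Rightarrow> bool" where
  "C0_semigroup S \<longleftrightarrow>
     S 0 = id_blinfun \<and>
     (\<forall>s\<ge>0. \<forall>t\<ge>0. S (s + t) = S s o\<^sub>L S t) \<and>
     (\<forall>x. ((\<lambda>t. blinfun_apply (S t) x) \<longlongrightarrow> x) (at_right 0))"

definition kappa :: "(real \<Rightarrow> 'h::real_normed_vector \<Rightarrow>\<^sub>L 'h) \<Rightarrow> real \<Rightarrow> real" where
  "kappa S_H t = (SUP s\<in>{0..t}. norm (S_H s))"

text \<open>The adjoint \<open>i\<^sup>* : E\<^sup>* \<rightarrow> H\<close>, with \<open>H\<close> identified with its dual; the Riesz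
  representation theorem makes the description well defined.\<close>

definition embedding_adjoint ::
  "('h::{real_inner,banach} \<Rightarrow>\<^sub>L 'e::banach) \<Rightarrow> ('e \<Rightarrow>\<^sub>L real) \<Rightarrow> 'h" where
  "embedding_adjoint i x' = (THE u. \<forall>h. inner u h = blinfun_apply x' (blinfun_apply i h))"

section \<open>Square integrable functions and operators on them\<close>

text \<open>No separability is assumed, so strong measurability (almost everywhere limit of simple
  functions) is not the same as Borel measurability.\<close>

definition strongly_measurable :: "'a measure \<Rightarrow> ('a \<Rightarrow> 'b::topological_space) \<Rightarrow> bool" where
  "strongly_measurable M g \<longleftrightarrow>
     (\<exists>s. (\<forall>n::nat. simple_function M (s n)) \<and> (AE x in M. (\<lambda>n. s n x) \<longlonglongrightarrow> g x))"

text \<open>The space \<open>L\<^sup>2(J;H)\<close>, represented by functions rather than equivalence classes.\<close>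

definition L2 :: "real set \<Rightarrow> (real \<Rightarrow> 'h::real_normed_vector) set" where
  "L2 J = {g. strongly_measurable (lebesgue_on J) g \<and>
              integrable (lebesgue_on J) (\<lambda>s. (norm (g s))\<^sup>2)}"

definition L2_bounded_linear ::
  "real set \<Rightarrow> ((real \<Rightarrow> 'h::real_normed_vector) \<Rightarrow> 'e::real_normed_vector) \<Rightarrow> bool" where
  "L2_bounded_linear J T \<longleftrightarrow>
     (\<forall>g\<in>L2 J. \<forall>h\<in>L2 J. T (\<lambda>s. g s + h s) = T g + T h) \<and>
     (\<forall>c. \<forall>g\<in>L2 J. T (\<lambda>s. c *\<^sub>R g s) = c *\<^sub>R T g) \<and>
     (\<exists>C. \<forall>g\<in>L2 J. norm (T g) \<le> C * sqrt (LINT s|lebesgue_on J. (norm (g s))\<^sup>2))"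

text \<open>\<open>g\<close> represents the class \<open>T\<^sup>* x' \<in> L\<^sup>2(J;H)\<close>.\<close>

definition L2_adjoint ::
  "real set \<Rightarrow> ((real \<Rightarrow> 'h::real_inner) \<Rightarrow> 'e::real_normed_vector) \<Rightarrow>
     ('e \<Rightarrow>\<^sub>L real) \<Rightarrow> (real \<Rightarrow> 'h) \<Rightarrow> bool" where
  "L2_adjoint J T x' g \<longleftrightarrow>
     g \<in> L2 J \<and>
     (\<forall>h\<in>L2 J. blinfun_apply x' (T h) = (LINT s|lebesgue_on J. inner (g s) (h s)))"

text \<open>\<open>Q = T T\<^sup>*\<close> as an operator \<open>E\<^sup>* \<rightarrow> E\<close>.\<close>

definition is_T_T_adjoint ::
  "real set \<Rightarrow> ((real \<Rightarrow> 'h::real_inner) \<Rightarrow> 'e::real_normed_vector) \<Rightarrow>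
     (('e \<Rightarrow>\<^sub>L real) \<Rightarrow> 'e) \<Rightarrow> bool" where
  "is_T_T_adjoint J T Q \<longleftrightarrow> (\<forall>x'. \<exists>g. L2_adjoint J T x' g \<and> Q x' = T g)"

text \<open>The operator \<open>g \<mapsto> \<integral>\<^sub>J S(s) i g(s) ds\<close>. The Bochner integral of the library needs a
  second countable target space, hence the Henstock-Kurzweil integral, which extends it and which
  over an unbounded interval is the norm limit of the integrals over compact intervals.\<close>

definition I_op ::
  "(real \<Rightarrow> 'e::banach \<Rightarrow>\<^sub>L 'e) \<Rightarrow> ('h::real_normed_vector \<Rightarrow>\<^sub>L 'e) \<Rightarrow>
     real set \<Rightarrow> (real \<Rightarrow> 'h) \<Rightarrow> 'e" where
  "I_op S i J g = integral J (\<lambda>s. blinfun_apply (S s) (blinfun_apply i (g s)))"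

definition I_op_defined ::
  "(real \<Rightarrow> 'e::banach \<Rightarrow>\<^sub>L 'e) \<Rightarrow> ('h::real_normed_vector \<Rightarrow>\<^sub>L 'e) \<Rightarrow> real set \<Rightarrow> bool" where
  "I_op_defined S i J \<longleftrightarrow>
     (\<forall>g\<in>L2 J. (\<lambda>s. blinfun_apply (S s) (blinfun_apply i (g s))) integrable_on J)"

section \<open>Gaussian Radon measures\<close>

definition radon_prob :: "'e::topological_space measure \<Rightarrow> bool" where
  "radon_prob \<mu> \<longleftrightarrow>
     sets \<mu> = sets borel \<and> prob_space \<mu> \<and>
     (\<forall>B\<in>sets borel. emeasure \<mu> B = (SUP K\<in>{K. compact K \<and> K \<subseteq> B}. emeasure \<mu> K))"

definition centred_gaussian_real :: "real measure \<Rightarrow> bool" where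
  "centred_gaussian_real \<nu> \<longleftrightarrow>
     \<nu> = return borel 0 \<or> (\<exists>\<sigma>>0. \<nu> = density lborel (\<lambda>x. ennreal (normal_density 0 \<sigma> x)))"

definition centred_gaussian_radon :: "'e::real_normed_vector measure \<Rightarrow> bool" where
  "centred_gaussian_radon \<mu> \<longleftrightarrow>
     radon_prob \<mu> \<and>
     (\<forall>x' :: 'e \<Rightarrow>\<^sub>L real. centred_gaussian_real (distr \<mu> borel (blinfun_apply x')))"

definition covariance_operator ::
  "'e::real_normed_vector measure \<Rightarrow> (('e \<Rightarrow>\<^sub>L real) \<Rightarrow> 'e) \<Rightarrow> bool" where
  "covariance_operator \<mu> Q \<longleftrightarrow>
     (\<forall>x' y'. blinfun_apply y' (Q x') =
        (LINT y|\<mu>. blinfun_apply x' y * blinfun_apply y' y))"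

definition gaussian_measure_of ::
  "real set \<Rightarrow> ((real \<Rightarrow> 'h::real_inner) \<Rightarrow> 'e::real_normed_vector) \<Rightarrow> 'e measure \<Rightarrow> bool" where
  "gaussian_measure_of J T \<mu> \<longleftrightarrow>
     centred_gaussian_radon \<mu> \<and> (\<exists>Q. is_T_T_adjoint J T Q \<and> covariance_operator \<mu> Q)"

text \<open>The operator \<open>T\<close> maps the standard cylindrical Gaussian measure of \<open>L\<^sup>2(J;H)\<close> to the
  cylindrical measure with covariance \<open>T T\<^sup>*\<close>; it is \<open>\<gamma>\<close>-radonifying if the latter is given
  by a Radon measure.\<close>

definition gamma_radonifying ::
  "real set \<Rightarrow> ((real \<Rightarrow> 'h::real_inner) \<Rightarrow> 'e::real_normed_vector) \<Rightarrow> bool" where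
  "gamma_radonifying J T \<longleftrightarrow> L2_bounded_linear J T \<and> (\<exists>\<mu>. gaussian_measure_of J T \<mu>)"

section \<open>Cylindrical functions and the derivative in the directions of \<open>H\<close>\<close>

text \<open>A function on \<open>\<real>\<^sup>N\<close> is encoded as a function on sequences that depends on the first
  \<open>N\<close> coordinates only. For such functions continuity in the product topology on
  \<open>nat \<Rightarrow> real\<close> is continuity on \<open>\<real>\<^sup>N\<close>.\<close>

definition Cb0 :: "nat \<Rightarrow> ((nat \<Rightarrow> real) \<Rightarrow> real) set" where
  "Cb0 N = {\<phi>. (\<forall>v w. (\<forall>n<N. v n = w n) \<longrightarrow> \<phi> v = \<phi> w) \<and>
                continuous_on UNIV \<phi> \<and> bounded (range \<phi>)}"

definition partial_deriv :: "nat \<Rightarrow> ((nat \<Rightarrow> real) \<Rightarrow> real) \<Rightarrow> (nat \<Rightarrow> real) \<Rightarrow> real" where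
  "partial_deriv n \<phi> v = deriv (\<lambda>r. \<phi> (v(n := r))) (v n)"

text \<open>\<open>C\<^sub>b\<^sup>k(\<real>\<^sup>N)\<close>: all partial derivatives up to order \<open>k\<close> exist and are bounded and
  continuous.\<close>

primrec Cb :: "nat \<Rightarrow> nat \<Rightarrow> ((nat \<Rightarrow> real) \<Rightarrow> real) set" where
  "Cb 0 N = Cb0 N"
| "Cb (Suc k) N = {\<phi> \<in> Cb0 N. \<forall>n<N.
      (\<forall>v. (\<lambda>r. \<phi> (v(n := r))) field_differentiable at (v n)) \<and> partial_deriv n \<phi> \<in> Cb k N}"

definition cylindrical_rep ::
  "nat \<Rightarrow> nat \<Rightarrow> ((nat \<Rightarrow> real) \<Rightarrow> real) \<Rightarrow> (nat \<Rightarrow> 'e::real_normed_vector \<Rightarrow>\<^sub>L real) \<Rightarrow>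
     ('e \<Rightarrow> real) \<Rightarrow> bool" where
  "cylindrical_rep k N \<phi> x' f \<longleftrightarrow>
     N \<ge> 1 \<and> \<phi> \<in> Cb k N \<and> f = (\<lambda>x. \<phi> (\<lambda>n. blinfun_apply (x' n) x))"

text \<open>The space \<open>FC\<^sub>b\<^sup>k\<^sup>,\<^sup>0(E)\<close>.\<close>

definition FCb :: "nat \<Rightarrow> ('e::real_normed_vector \<Rightarrow> real) set" where
  "FCb k = {f. \<exists>N \<phi> x'. cylindrical_rep k N \<phi> x' f}"

text \<open>For \<open>f \<in> FCb 1\<close> the value does not depend on the representation of \<open>f\<close>: its inner
  product with \<open>h\<close> is the derivative of \<open>f\<close> at \<open>x\<close> in the direction \<open>i h\<close>.\<close>

definition D_H ::
  "('h::{real_inner,banach} \<Rightarrow>\<^sub>L 'e::banach) \<Rightarrow> ('e \<Rightarrow> real) \<Rightarrow> 'e \<Rightarrow> 'h" where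
  "D_H i f x = (THE d. \<exists>N \<phi> x'. cylindrical_rep 1 N \<phi> x' f \<and>
     d = (\<Sum>n<N. partial_deriv n \<phi> (\<lambda>m. blinfun_apply (x' m) x) *\<^sub>R embedding_adjoint i (x' n)))"

section \<open>The Ornstein-Uhlenbeck semigroup\<close>

definition OU ::
  "(real \<Rightarrow> 'e::real_normed_vector \<Rightarrow>\<^sub>L 'e) \<Rightarrow> (real \<Rightarrow> 'e measure) \<Rightarrow>
     real \<Rightarrow> ('e \<Rightarrow> real) \<Rightarrow> 'e \<Rightarrow> real" where
  "OU S \<mu> t f x = (LINT y|\<mu> t. f (blinfun_apply (S t) x + y))"

end

theory Submission imports Defs begin

text \<open>
  Fix \<open>t > 0\<close>, a function \<open>f\<close> and a point \<open>x\<close>, and put \<open>h = D\<^sub>H P(t) f(x)\<close> and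
  \<open>F(y) = f(S(t) x + y)\<close>. Then \<open>\<bar>h\<bar>\<^sup>2\<close> is the derivative of \<open>P(t) f\<close> at \<open>x\<close> in the direction
  \<open>i h\<close>, that is, the derivative of \<open>r \<mapsto> E F(Y + r S(t) i h)\<close> at \<open>0\<close>, where \<open>Y\<close> has the
  distribution \<open>\<mu>\<^sub>t\<close>.

  The hypothesis on \<open>S\<^sub>H\<close> enters through the identity \<open>t S(t) i h = I\<^sub>t g\<close> with
  \<open>g(s) = S\<^sub>H(t - s) h\<close>, because \<open>S(s) i S\<^sub>H(t - s) h = S(t) i h\<close> for all \<open>s\<close> between \<open>0\<close> and
  \<open>t\<close>. Since the norm of \<open>g\<close> in \<open>L\<^sup>2\<close> is at most \<open>sqrt t \<kappa>(t) \<bar>h\<bar>\<close>, the direction \<open>S(t) i h\<close>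
  satisfies \<open>\<langle>S(t) i h, x'\<rangle>\<^sup>2 \<le> (\<kappa>(t) \<bar>h\<bar>)\<^sup>2 / t \<langle>Q x', x'\<rangle>\<close> for the covariance operator \<open>Q\<close> of
  \<open>\<mu>\<^sub>t\<close> (\<open>smoothing_direction_bound\<close>).

  As \<open>f\<close> depends only on finitely many functionals, linear algebra replaces \<open>S(t) i h\<close> by a direction
  \<open>Q \<xi>\<close>, where \<open>\<xi>\<close> is a linear combination of these functionals and
  \<open>\<langle>Q \<xi>, \<xi>\<rangle> \<le> (\<kappa>(t) \<bar>h\<bar>)\<^sup>2 / t\<close> (\<open>bilinear_representation_on_finite\<close>). Integration by parts with
  respect to a Gaussian measure then gives \<open>\<bar>h\<bar>\<^sup>2 = E \<xi>(Y) F(Y)\<close>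
  (\<open>gaussian_integration_by_parts\<close>). By Hoelder's inequality this is at most
  \<open>(P(t)\<bar>f\<bar>\<^sup>p(x))\<^bsup>1/p\<^esup>\<close> times the norm of \<open>\<xi>(Y)\<close> in \<open>L\<^sup>q\<close>, where \<open>1/p + 1/q = 1\<close>. As \<open>\<xi>(Y)\<close> is a
  centred normal variable, this norm is a constant depending only on \<open>q\<close> times the standard deviation
  of \<open>\<xi>(Y)\<close>, which is at most \<open>\<kappa>(t) \<bar>h\<bar> / sqrt t\<close>. Dividing by \<open>\<bar>h\<bar>\<close> yields the estimate.

  Only the one-dimensional marginals of \<open>\<mu>\<^sub>t\<close> are known to be normal, so integration by parts is
  obtained by approximation. For \<open>F = sin \<eta>\<close> and \<open>F = cos \<eta>\<close> with a functional \<open>\<eta>\<close>, the integrated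
  form \<open>E F(Y + r Q \<xi>) - E F(Y) = \<integral>\<^sub>0\<^sup>r E \<xi>(Y) F(Y + u Q \<xi>) du\<close> can be computed. It is preserved
  under bounded pointwise limits and contains no derivative of \<open>F\<close>, so the Stone--Weierstrass theorem
  extends it to all bounded continuous cylindrical functions (\<open>translation_identity_cylindrical\<close>).
\<close>

section \<open>The Riesz representation and semi-inner products\<close>

lemma Riesz_representation:
  fixes f :: "'h::{real_inner,banach} \<Rightarrow>\<^sub>L real"
  shows "\<exists>u. \<forall>h. inner u h = blinfun_apply f h"
proof -
  \<comment> \<open>The representing vector minimises the functional \<open>J\<close>; minimising sequences are Cauchy by the
    parallelogram identity.\<close>
  define J where "J h = (norm h)\<^sup>2 - 2 * blinfun_apply f h" for h
  have lower: "J h \<ge> - (norm f)\<^sup>2" for h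
  proof -
    have "blinfun_apply f h \<le> norm f * norm h"
      using norm_blinfun[of f h] by (simp add: abs_le_iff)
    moreover have "0 \<le> (norm h - norm f)\<^sup>2" by simp
    ultimately show ?thesis unfolding J_def by (simp add: power2_diff mult.commute[of "norm f"])
  qed
  define m where "m = (INF h. J h)"
  have bdd: "bdd_below (range J)" using lower by (auto simp: bdd_below_def)
  have m_le: "m \<le> J h" for h unfolding m_def by (rule cINF_lower[OF bdd]) simp
  have "\<exists>h. J h < m + 1 / (real n + 1)" for n
    using cINF_less_iff[OF _ bdd, of "m + 1 / (real n + 1)"] unfolding m_def by auto
  then obtain a where a: "\<And>n. J (a n) < m + 1 / (real n + 1)" by metis
  have gap: "(norm (x - y))\<^sup>2 = 2 * J x + 2 * J y - 4 * J ((1/2) *\<^sub>R (x + y))" for x y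
    unfolding J_def power2_norm_eq_inner
    by (simp add: inner_simps blinfun.bilinear_simps algebra_simps inner_commute)
  have "Cauchy a"
  proof (rule metric_CauchyI)
    fix e :: real assume e: "e > 0"
    obtain k :: nat where k: "4 / e\<^sup>2 < real k" using reals_Archimedean2 by blast
    have "dist (a n) (a l) < e" if n: "n \<ge> k" and l: "l \<ge> k" for n l
    proof -
      have k0: "0 < real k" using k e by (smt (verit) divide_pos_pos zero_less_power)
      have "1 / (real n + 1) < 1 / real k" "1 / (real l + 1) < 1 / real k"
        using n l k0 by (auto intro!: divide_strict_left_mono mult_pos_pos)
      moreover have "1 / real k < e\<^sup>2 / 4" using k e k0 by (simp add: field_simps)
      ultimately have "(norm (a n - a l))\<^sup>2 < e\<^sup>2"
        using gap[of "a n" "a l"] a[of n] a[of l] m_le[of "(1/2) *\<^sub>R (a n + a l)"] by linarith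
      then show ?thesis using e by (simp add: dist_norm power_less_imp_less_base)
    qed
    then show "\<exists>M. \<forall>m\<ge>M. \<forall>n\<ge>M. dist (a m) (a n) < e" by blast
  qed
  then obtain u where u: "a \<longlonglongrightarrow> u" by (meson Cauchy_convergent convergent_def)
  have "J u \<le> m"
  proof (rule LIMSEQ_le)
    show "(\<lambda>n. J (a n)) \<longlonglongrightarrow> J u" unfolding J_def by (intro tendsto_intros u)
    show "(\<lambda>n. m + 1 / (real n + 1)) \<longlonglongrightarrow> m"
      using LIMSEQ_inverse_real_of_nat_add[of m] by (simp add: inverse_eq_divide add.commute)
    show "\<exists>N. \<forall>n\<ge>N. J (a n) \<le> m + 1 / (real n + 1)" using a less_imp_le by blast
  qed
  have "inner u h = blinfun_apply f h" for h
  proof (rule ccontr)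
    assume ne: "inner u h \<noteq> blinfun_apply f h"
    define d where "d = inner u h - blinfun_apply f h"
    define s where "s = - d / ((norm h)\<^sup>2 + 1)"
    have pos: "(norm h)\<^sup>2 + 1 > 0" by (smt (verit) zero_le_power2)
    have "J (u + s *\<^sub>R h) = J u + 2 * s * d + s\<^sup>2 * (norm h)\<^sup>2"
      unfolding J_def d_def power2_norm_eq_inner
      by (simp add: inner_simps blinfun.bilinear_simps algebra_simps inner_commute power2_eq_square)
    then have "0 \<le> 2 * s * d + s\<^sup>2 * (norm h)\<^sup>2"
      using m_le[of "u + s *\<^sub>R h"] \<open>J u \<le> m\<close> by linarith
    also have "\<dots> \<le> 2 * s * d + s\<^sup>2 * ((norm h)\<^sup>2 + 1)"
      by (simp add: mult_left_mono)
    also have "s\<^sup>2 * ((norm h)\<^sup>2 + 1) = - s * d"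
      using pos unfolding s_def by (simp add: power2_eq_square)
    also have "2 * s * d + - s * d = - (d\<^sup>2 / ((norm h)\<^sup>2 + 1))"
      unfolding s_def by (simp add: power2_eq_square)
    also have "\<dots> < 0" using ne pos unfolding d_def by simp
    finally show False by simp
  qed
  then show ?thesis by blast
qed

lemma inner_embedding_adjoint:
  fixes i :: "'h::{real_inner,banach} \<Rightarrow>\<^sub>L 'e::banach"
  shows "inner (embedding_adjoint i x') h = blinfun_apply x' (blinfun_apply i h)"
proof -
  obtain u where u: "\<forall>h. inner u h = blinfun_apply x' (blinfun_apply i h)"
    using Riesz_representation[of "x' o\<^sub>L i"] by auto
  have "v = u" if "\<forall>h. inner v h = blinfun_apply x' (blinfun_apply i h)" for v
    using u that by (metis vector_eq_ldot inner_commute)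
  with u have "\<forall>h. inner (embedding_adjoint i x') h = blinfun_apply x' (blinfun_apply i h)"
    unfolding embedding_adjoint_def by (rule theI[where a=u])
  then show ?thesis by blast
qed

text \<open>A functional that is bounded for the seminorm of a semi-inner product \<open>B\<close> agrees on finitely many
  vectors with \<open>B z\<close> for a vector \<open>z\<close> of their span. The form \<open>B\<close> may be degenerate. The induction
  is the Gram--Schmidt procedure: the projection \<open>w\<close> of the new vector \<open>v\<close> is itself obtained from the
  induction hypothesis, applied to the functional \<open>B v\<close>.\<close>

lemma bilinear_representation_on_finite:
  fixes B :: "'v::real_vector \<Rightarrow> 'v \<Rightarrow> real" and l :: "'v \<Rightarrow> real"
  assumes fin: "finite X" and lin: "\<And>z. linear (B z)" and sym: "\<And>x y. B x y = B y x"
    and pos: "\<And>x. B x x \<ge> 0"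
    and l: "linear l" "\<And>x. (l x)\<^sup>2 \<le> K * B x x"
  shows "\<exists>z\<in>span X. \<forall>x\<in>X. B z x = l x"
  using fin l
proof (induction X arbitrary: l K rule: finite_induct)
  case empty
  then show ?case by (auto intro: span_0)
next
  case (insert v X)
  have add: "B x (y + z) = B x y + B x z" "B (y + z) x = B y x + B z x"
    "B x (y - z) = B x y - B x z" "B (y - z) x = B y x - B z x"
    "B x (c *\<^sub>R y) = c * B x y" "B (c *\<^sub>R y) x = c * B y x" for x y z c
    using lin[of x] sym by (auto simp: linear_add linear_diff linear_cmul)
  \<comment> \<open>Cauchy--Schwarz for the semi-inner product\<close>
  have CS: "(B x y)\<^sup>2 \<le> B x x * B y y" for x y
  proof (cases "B y y = 0")
    case True
    have "0 \<le> B x x + 2 * s * B x y" for s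
      using pos[of "x + s *\<^sub>R y"] True by (simp add: add sym[of y x] algebra_simps)
    from this[of "- (B x x + 1) / (2 * B x y)"] have "B x y = 0" by (cases "B x y = 0") (auto simp: field_simps)
    then show ?thesis using True by simp
  next
    case False
    then have y: "B y y > 0" using pos[of y] by simp
    have "0 \<le> B (x - (B x y / B y y) *\<^sub>R y) (x - (B x y / B y y) *\<^sub>R y)" by (rule pos)
    also have "\<dots> = B x x - (B x y)\<^sup>2 / B y y"
      using False by (simp add: add sym[of y x] power2_eq_square)
    finally show ?thesis using y by (simp add: field_simps)
  qed
  obtain w where w: "w \<in> span X" "\<forall>x\<in>X. B w x = B v x"
    using insert.IH[OF lin[of v], of "B v v"] CS by auto
  obtain z where z: "z \<in> span X" "\<forall>x\<in>X. B z x = l x"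
    using insert.IH[OF insert.prems] by auto
  define y where "y = v - w"
  have yX: "B y x = 0" if "x \<in> span X" for x
    using that
  proof (induction rule: span_induct)
    case base
    show ?case by (simp add: subspace_def add linear_0[OF lin])
  next
    case (step x)
    then show ?case using w(2) by (simp add: y_def add)
  qed
  \<comment> \<open>If \<open>B y y = 0\<close>, both \<open>l y\<close> and \<open>B z y\<close> vanish and any coefficient will do.\<close>
  define \<beta> where "\<beta> = (l y - B z y) / B y y"
  have \<beta>: "\<beta> * B y y = l y - B z y"
  proof (cases "B y y = 0")
    case True
    have "(l y)\<^sup>2 \<le> 0" "(B z y)\<^sup>2 \<le> 0" using insert.prems(2)[of y] CS[of z y] True by auto
    then show ?thesis using True by simp
  qed (simp add: \<beta>_def)
  define u where "u = z + \<beta> *\<^sub>R y"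
  have sub: "span X \<subseteq> span (insert v X)" by (rule span_mono) auto
  have "u \<in> span (insert v X)"
    unfolding u_def y_def using w(1) z(1) sub
    by (intro span_add span_scale span_diff) (auto intro: span_base)
  moreover have uX: "B u x = l x" if "x \<in> X" for x
    using that z(2) yX[OF span_base[OF that]] by (simp add: u_def add)
  moreover have "B u v = l v"
  proof -
    have uw: "B u w = l w"
      using w(1)
    proof (induction rule: span_induct)
      case base
      show ?case using insert.prems(1) lin[of u]
        by (simp add: subspace_def linear_add linear_cmul linear_0)
    next
      case (step x) then show ?case by (rule uX)
    qed
    have "B u y = l y" using \<beta> by (simp add: u_def add)
    then have "B u (y + w) = l (y + w)"
      using uw insert.prems(1) by (simp add: add linear_add)
    then show ?thesis by (simp add: y_def)
  qed
  ultimately show ?case by auto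
qed

section \<open>Inequalities and differentiation under the integral\<close>

lemma Hoelder_inequality:
  fixes f g :: "'a \<Rightarrow> real"
  assumes p: "p > 1" "q > 1" "1 / p + 1 / q = 1"
    and [measurable]: "f \<in> borel_measurable M" "g \<in> borel_measurable M"
    and f: "integrable M (\<lambda>x. \<bar>f x\<bar> powr p)" and g: "integrable M (\<lambda>x. \<bar>g x\<bar> powr q)"
  shows "\<bar>LINT x|M. f x * g x\<bar>
           \<le> (LINT x|M. \<bar>f x\<bar> powr p) powr (1 / p) * (LINT x|M. \<bar>g x\<bar> powr q) powr (1 / q)"
proof -
  define A where "A = (LINT x|M. \<bar>f x\<bar> powr p)"
  define B where "B = (LINT x|M. \<bar>g x\<bar> powr q)"
  have A0: "A \<ge> 0" and B0: "B \<ge> 0" unfolding A_def B_def by simp_all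
  show ?thesis
  proof (cases "A = 0 \<or> B = 0")
    case True
    then have "AE x in M. f x * g x = 0"
    proof
      assume "A = 0"
      then have "AE x in M. \<bar>f x\<bar> powr p = 0"
        using integral_nonneg_eq_0_iff_AE[OF f] unfolding A_def by simp
      then show ?thesis by (auto elim!: eventually_mono)
    next
      assume "B = 0"
      then have "AE x in M. \<bar>g x\<bar> powr q = 0"
        using integral_nonneg_eq_0_iff_AE[OF g] unfolding B_def by simp
      then show ?thesis by (auto elim!: eventually_mono)
    qed
    then have "(LINT x|M. f x * g x) = 0" by (subst integral_cong_AE[where g="\<lambda>_. 0"]) auto
    then show ?thesis by simp
  next
    case False
    with A0 B0 have A: "A > 0" and B: "B > 0" by auto
    define a where "a = A powr (1 / p)"
    define b where "b = B powr (1 / q)"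
    have ab: "a > 0" "b > 0" unfolding a_def b_def using A B by auto
    have ap: "a powr p = A" and bq: "b powr q = B"
      unfolding a_def b_def using A B p by (auto simp: powr_powr)
    have young: "\<bar>f x * g x\<bar> \<le> a * b * (\<bar>f x\<bar> powr p / (A * p) + \<bar>g x\<bar> powr q / (B * q))" for x
    proof -
      have "(\<bar>f x\<bar> / a) * (\<bar>g x\<bar> / b) \<le> (\<bar>f x\<bar> / a) powr p / p + (\<bar>g x\<bar> / b) powr q / q"
        using p ab by (intro Youngs_inequality) auto
      also have "\<dots> = \<bar>f x\<bar> powr p / (A * p) + \<bar>g x\<bar> powr q / (B * q)"
        using ab by (simp add: powr_divide ap bq)
      finally show ?thesis using ab by (simp add: abs_mult field_simps)
    qed
    have "\<bar>LINT x|M. f x * g x\<bar> \<le> (LINT x|M. \<bar>f x * g x\<bar>)" by (rule integral_abs_bound)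
    also have "\<dots> \<le> (LINT x|M. a * b * (\<bar>f x\<bar> powr p / (A * p) + \<bar>g x\<bar> powr q / (B * q)))"
    proof (rule integral_mono_AE')
      show "integrable M (\<lambda>x. a * b * (\<bar>f x\<bar> powr p / (A * p) + \<bar>g x\<bar> powr q / (B * q)))"
        using f g by (intro Bochner_Integration.integrable_mult_right
           Bochner_Integration.integrable_add integrable_divide) auto
      show "AE x in M. \<bar>f x * g x\<bar> \<le> a * b * (\<bar>f x\<bar> powr p / (A * p) + \<bar>g x\<bar> powr q / (B * q))"
        using young by simp
      have "0 \<le> a * b * (\<bar>f x\<bar> powr p / (A * p) + \<bar>g x\<bar> powr q / (B * q))" for x
        using young[of x] abs_ge_zero order_trans by blast
      then show "AE x in M. 0 \<le> a * b * (\<bar>f x\<bar> powr p / (A * p) + \<bar>g x\<bar> powr q / (B * q))"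
        by simp
    qed
    also have "\<dots> = a * b * (A / (A * p) + B / (B * q))"
      using f g by (simp add: A_def B_def Bochner_Integration.integral_add)
    also have "\<dots> = a * b" using A B p by simp
    finally show ?thesis unfolding a_def b_def A_def B_def .
  qed
qed

lemma has_real_derivative_integral:
  fixes G G' :: "real \<Rightarrow> 'a \<Rightarrow> real"
  assumes der: "\<And>r y. ((\<lambda>r. G r y) has_real_derivative G' r y) (at r)"
    and int: "\<And>r. integrable M (G r)" and G': "G' s \<in> borel_measurable M"
    and bound: "\<And>r y. \<bar>G' r y\<bar> \<le> K y" and K: "integrable M K"
  shows "((\<lambda>r. LINT y|M. G r y) has_real_derivative (LINT y|M. G' s y)) (at s)"
proof -
  have "((\<lambda>h. ((LINT y|M. G (s + h) y) - (LINT y|M. G s y)) / h) \<longlongrightarrow> (LINT y|M. G' s y)) (at 0)"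
    unfolding tendsto_at_iff_sequentially
  proof (intro allI impI)
    fix X :: "nat \<Rightarrow> real" assume X: "\<forall>i. X i \<in> UNIV - {0}" "X \<longlonglongrightarrow> 0"
    have "(\<lambda>n. LINT y|M. (G (s + X n) y - G s y) / X n) \<longlonglongrightarrow> (LINT y|M. G' s y)"
    proof (rule integral_dominated_convergence[where w=K])
      show "AE y in M. (\<lambda>n. (G (s + X n) y - G s y) / X n) \<longlonglongrightarrow> G' s y"
      proof (rule AE_I2)
        fix y
        have "((\<lambda>h. (G (s + h) y - G s y) / h) \<longlongrightarrow> G' s y) (at 0)"
          using der[where r=s and y=y] unfolding DERIV_def .
        then show "(\<lambda>n. (G (s + X n) y - G s y) / X n) \<longlonglongrightarrow> G' s y"
          unfolding tendsto_at_iff_sequentially comp_def using X by blast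
      qed
      show "AE y in M. norm ((G (s + X n) y - G s y) / X n) \<le> K y" for n
      proof (rule AE_I2)
        fix y
        have "norm (G (s + X n) y - G s y) \<le> K y * norm (s + X n - s)"
          by (rule field_differentiable_bound[where S=UNIV and f'="\<lambda>r. G' r y"])
            (use der bound in auto)
        then show "norm ((G (s + X n) y - G s y) / X n) \<le> K y"
          using X(1) by (simp add: field_simps)
      qed
    qed (use int G' K in \<open>auto intro!: borel_measurable_integrable borel_measurable_divide borel_measurable_diff\<close>)
    then show "((\<lambda>h. ((LINT y|M. G (s + h) y) - (LINT y|M. G s y)) / h) \<circ> X) \<longlonglongrightarrow> (LINT y|M. G' s y)"
      using int by (simp add: comp_def Bochner_Integration.integral_diff)
  qed
  then show ?thesis unfolding DERIV_def .
qed

section \<open>Orbits of a strongly continuous semigroup\<close>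

text \<open>The Banach--Steinhaus theorem for a sequence of operators. It serves to show that the supremum
  defining \<open>kappa\<close> is finite.\<close>

lemma uniform_boundedness:
  fixes T :: "nat \<Rightarrow> 'a::banach \<Rightarrow>\<^sub>L 'b::real_normed_vector"
  assumes bdd: "\<And>x. bounded (range (\<lambda>n. blinfun_apply (T n) x))"
  shows "bounded (range T)"
proof -
  define F where "F k = {x. \<forall>n. norm (blinfun_apply (T n) x) \<le> real k}" for k
  have cl: "closed (F k)" for k
    unfolding F_def by (intro closed_Collect_all closed_Collect_le continuous_intros)
  have cover: "(\<Union>k. F k) = UNIV"
  proof -
    have "\<exists>k. x \<in> F k" for x
    proof -
      obtain B where "\<forall>n. norm (blinfun_apply (T n) x) \<le> B"
        using bdd[of x] unfolding bounded_iff by auto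
      moreover obtain k where "B \<le> real k" using real_arch_simple by blast
      ultimately show ?thesis unfolding F_def by (auto intro: order_trans)
    qed
    then show ?thesis by auto
  qed
  have "\<exists>k. interior (F k) \<noteq> {}"
  proof (rule ccontr)
    assume "\<not> ?thesis"
    then have "euclidean interior_of \<Union>(range F) = {}"
      using Met_TC.metric_Baire_category_alt[where \<G>="range F" and 'a='a] cl
      by (auto simp: mcomplete_iff_complete complete_UNIV)
    then show False using cover by simp
  qed
  then obtain k x where "x \<in> interior (F k)" by auto
  then obtain r where r: "r > 0" "cball x r \<subseteq> F k"
    by (meson mem_interior_cball)
  have "norm (T n) \<le> 2 * real k / r" for n
  proof (rule norm_blinfun_bound)
    show "0 \<le> 2 * real k / r" using r by simp
    fix y
    show "norm (blinfun_apply (T n) y) \<le> 2 * real k / r * norm y"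
    proof (cases "y = 0")
      case False
      define z where "z = (r / norm y) *\<^sub>R y"
      have "x + z \<in> F k" "x \<in> F k"
        using r False by (auto simp: z_def dist_norm intro!: subsetD[OF r(2)])
      then have "norm (blinfun_apply (T n) (x + z)) \<le> real k" "norm (blinfun_apply (T n) x) \<le> real k"
        unfolding F_def by auto
      moreover have "blinfun_apply (T n) z = blinfun_apply (T n) (x + z) - blinfun_apply (T n) x"
        by (simp add: blinfun.bilinear_simps)
      ultimately have "norm (blinfun_apply (T n) z) \<le> 2 * real k"
        by (metis add_mono mult_2 norm_triangle_ineq4 order_trans)
      then show ?thesis using r False unfolding z_def
        by (simp add: blinfun.bilinear_simps field_simps)
    qed simp
  qed
  then show ?thesis unfolding bounded_iff by auto
qed

lemma C0_semigroup_tendsto: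
  assumes T: "C0_semigroup T" and s: "\<And>n::nat. s n \<ge> 0" "s \<longlonglongrightarrow> 0"
  shows "(\<lambda>n. blinfun_apply (T (s n)) x) \<longlonglongrightarrow> x"
proof (rule metric_LIMSEQ_I)
  fix e :: real assume e: "e > 0"
  have "\<forall>\<^sub>F t in at_right 0. dist (blinfun_apply (T t) x) x < e"
    using T e unfolding C0_semigroup_def tendsto_iff by blast
  then obtain b where b: "b > 0" "\<And>t. 0 < t \<Longrightarrow> t < b \<Longrightarrow> dist (blinfun_apply (T t) x) x < e"
    unfolding eventually_at_right_field by auto
  have T0: "blinfun_apply (T 0) x = x" using T unfolding C0_semigroup_def by simp
  obtain N where N: "\<And>n. n \<ge> N \<Longrightarrow> dist (s n) 0 < b" using metric_LIMSEQ_D[OF s(2) b(1)] by blast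
  then have "dist (blinfun_apply (T (s n)) x) x < e" if "n \<ge> N" for n
    using N[of n] that s(1)[of n] b(2)[of "s n"] T0 e
    by (cases "s n = 0") auto
  then show "\<exists>N. \<forall>n\<ge>N. dist (blinfun_apply (T (s n)) x) x < e" by blast
qed

lemma C0_semigroup_locally_bounded:
  assumes T: "C0_semigroup T"
  shows "bdd_above ((\<lambda>s. norm (T s)) ` {0..t})"
proof -
  \<comment> \<open>Boundedness near \<open>0\<close> is all that strong continuity gives directly; the semigroup law
    then propagates it.\<close>
  have "\<exists>\<delta>>0. \<exists>M. \<forall>s\<in>{0..\<delta>}. norm (T s) \<le> M"
  proof (rule ccontr)
    assume "\<not> ?thesis"
    then have "\<exists>s\<in>{0..1 / (real n + 1)}. norm (T s) > real n" for n
      by (meson not_le of_nat_0_le_iff add_nonneg_pos zero_less_one divide_pos_pos)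
    then obtain s where s: "\<And>n. s n \<in> {0..1 / (real n + 1)}" "\<And>n. norm (T (s n)) > real n" by metis
    have "s \<longlonglongrightarrow> 0"
    proof (rule tendsto_sandwich)
      show "\<forall>\<^sub>F n in sequentially. 0 \<le> s n" "\<forall>\<^sub>F n in sequentially. s n \<le> 1 / (real n + 1)"
        using s(1) by auto
      show "(\<lambda>n. 1 / (real n + 1)) \<longlonglongrightarrow> 0"
        using LIMSEQ_inverse_real_of_nat by (simp add: inverse_eq_divide add.commute)
    qed simp
    then have "bounded (range (\<lambda>n. blinfun_apply (T (s n)) x))" for x
      using C0_semigroup_tendsto[OF T, of s x] s(1)
      by (intro convergent_imp_bounded) auto
    then have "bounded (range (\<lambda>n. T (s n)))" by (rule uniform_boundedness)
    then obtain M where "\<And>n. norm (T (s n)) \<le> M" unfolding bounded_iff by auto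
    moreover obtain n where "M < real n" using reals_Archimedean2 by blast
    ultimately show False using s(2)[of n] by (meson less_trans not_le)
  qed
  then obtain \<delta> M where \<delta>: "\<delta> > 0" and M': "\<forall>s\<in>{0..\<delta>}. norm (T s) \<le> M" by blast
  have M: "norm (T s) \<le> M" if "0 \<le> s" "s \<le> \<delta>" for s using M' that by simp
  have M0: "M \<ge> 0" using order_trans[OF norm_ge_zero M[of 0]] \<delta> by simp
  have grow: "\<exists>K. \<forall>s. 0 \<le> s \<longrightarrow> s \<le> real n * \<delta> \<longrightarrow> norm (T s) \<le> K" for n
  proof (induction n)
    case 0
    then show ?case by (auto intro!: exI[of _ "norm (T 0)"])
  next
    case (Suc n)
    then obtain K where K: "\<And>s. 0 \<le> s \<Longrightarrow> s \<le> real n * \<delta> \<Longrightarrow> norm (T s) \<le> K" by blast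
    have "norm (T s) \<le> max M (M * K)" if s: "0 \<le> s" "s \<le> real (Suc n) * \<delta>" for s
    proof (cases "s \<le> \<delta>")
      case True
      then show ?thesis using M[of s] s by simp
    next
      case False
      have "T s = T \<delta> o\<^sub>L T (s - \<delta>)"
        using T False \<delta> unfolding C0_semigroup_def
        by (metis add.commute diff_add_cancel diff_ge_0_iff_ge less_eq_real_def not_le)
      then have "norm (T s) \<le> norm (T \<delta>) * norm (T (s - \<delta>))" using norm_blinfun_compose by metis
      also have "\<dots> \<le> M * K"
        using M[of \<delta>] K[of "s - \<delta>"] \<delta> s False M0 by (intro mult_mono) (auto simp: algebra_simps)
      finally show ?thesis by simp
    qed
    then show ?case by blast
  qed
  obtain n where "t / \<delta> \<le> real n" using real_arch_simple by blast
  then have "t \<le> real n * \<delta>" using \<delta> by (simp add: field_simps)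
  moreover obtain K where "\<And>s. 0 \<le> s \<Longrightarrow> s \<le> real n * \<delta> \<Longrightarrow> norm (T s) \<le> K"
    using grow[of n] by blast
  ultimately show ?thesis by (intro bdd_aboveI[where M=K]) auto
qed

lemma norm_le_kappa:
  assumes "C0_semigroup T" "0 \<le> s" "s \<le> t"
  shows "norm (T s) \<le> kappa T t"
  unfolding kappa_def using assms C0_semigroup_locally_bounded
  by (intro cSUP_upper) auto

lemma kappa_nonneg: "C0_semigroup T \<Longrightarrow> t \<ge> 0 \<Longrightarrow> kappa T t \<ge> 0"
  using norm_le_kappa[of T 0 t] norm_ge_zero order_trans by blast

text \<open>The function \<open>s \<mapsto> T(t - s) h\<close> is the limit of its step functions at the largest multiple of
  \<open>1 / (n + 1)\<close> below \<open>s\<close>. There \<open>t - s\<close> is approached from above, so that right-continuity of the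
  orbit at \<open>t - s\<close> suffices.\<close>

lemma reversed_orbit_in_L2:
  assumes T: "C0_semigroup T" and t: "t > 0"
  shows "(\<lambda>s. blinfun_apply (T (t - s)) h) \<in> L2 {0<..<t}"
    and "(LINT s|lebesgue_on {0<..<t}. (norm (blinfun_apply (T (t - s)) h))\<^sup>2) \<le> t * (kappa T t * norm h)\<^sup>2"
proof -
  let ?M = "lebesgue_on {0<..<t}"
  define r where "r n s = \<lfloor>s * (real n + 1)\<rfloor>" for n :: nat and s :: real
  define g where "g n s = blinfun_apply (T (t - of_int (r n s) / (real n + 1))) h" for n s
  have simple: "simple_function ?M (g n)" for n
  proof -
    have "simple_function ?M (r n)"
      unfolding simple_function_def
    proof (intro conjI ballI)
      have "r n ` space ?M \<subseteq> {0..\<lfloor>t * (real n + 1)\<rfloor>}"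
        unfolding r_def by (auto intro!: floor_mono mult_right_mono)
      then show "finite (r n ` space ?M)" by (rule finite_subset) simp
      have "r n \<in> measurable borel (count_space UNIV)" unfolding r_def by measurable
      then have "r n \<in> measurable ?M (count_space UNIV)"
        by (intro measurable_restrict_space1 measurable_completion) simp
      then show "r n -` {x} \<inter> space ?M \<in> sets ?M" for x
        by (rule measurable_sets) simp
    qed
    from simple_function_compose1[OF this, of "\<lambda>k. blinfun_apply (T (t - of_int k / (real n + 1))) h"]
    show ?thesis unfolding g_def .
  qed
  have lim: "(\<lambda>n. g n s) \<longlonglongrightarrow> blinfun_apply (T (t - s)) h" if s: "s \<in> {0<..<t}" for s
  proof -
    define d where "d n = s - of_int (r n s) / (real n + 1)" for n
    have d: "0 \<le> d n" "d n \<le> 1 / (real n + 1)" for n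
    proof -
      have "of_int (r n s) \<le> s * (real n + 1)" "s * (real n + 1) < of_int (r n s) + 1"
        unfolding r_def by linarith+
      moreover have "d n = (s * (real n + 1) - of_int (r n s)) / (real n + 1)"
        unfolding d_def by (simp add: field_simps)
      ultimately show "0 \<le> d n" "d n \<le> 1 / (real n + 1)" by (auto intro: divide_right_mono)
    qed
    have "d \<longlonglongrightarrow> 0"
    proof (rule tendsto_sandwich)
      show "\<forall>\<^sub>F n in sequentially. 0 \<le> d n" "\<forall>\<^sub>F n in sequentially. d n \<le> 1 / (real n + 1)"
        using d by auto
      show "(\<lambda>n. 1 / (real n + 1)) \<longlonglongrightarrow> 0"
        using LIMSEQ_inverse_real_of_nat by (simp add: inverse_eq_divide add.commute)
    qed simp
    then have "(\<lambda>n. blinfun_apply (T (d n)) (blinfun_apply (T (t - s)) h)) \<longlonglongrightarrow> blinfun_apply (T (t - s)) h"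
      using d by (intro C0_semigroup_tendsto[OF T]) auto
    moreover have "g n s = blinfun_apply (T (d n)) (blinfun_apply (T (t - s)) h)" for n
    proof -
      have "T (d n + (t - s)) = T (d n) o\<^sub>L T (t - s)"
        using T d(1)[of n] s unfolding C0_semigroup_def by auto
      moreover have "d n + (t - s) = t - of_int (r n s) / (real n + 1)" unfolding d_def by simp
      ultimately show ?thesis unfolding g_def by simp
    qed
    ultimately show ?thesis by simp
  qed
  have meas: "strongly_measurable ?M (\<lambda>s. blinfun_apply (T (t - s)) h)"
    unfolding strongly_measurable_def using simple lim by (intro exI[of _ g]) auto
  have bound: "(norm (blinfun_apply (T (t - s)) h))\<^sup>2 \<le> (kappa T t * norm h)\<^sup>2" if "s \<in> {0<..<t}" for s
  proof -
    have "norm (blinfun_apply (T (t - s)) h) \<le> norm (T (t - s)) * norm h" by (rule norm_blinfun)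
    also have "\<dots> \<le> kappa T t * norm h"
      using norm_le_kappa[OF T, of "t - s" t] that by (intro mult_right_mono) auto
    finally show ?thesis by (simp add: power_mono)
  qed
  have "(\<lambda>s. (norm (blinfun_apply (T (t - s)) h))\<^sup>2) \<in> borel_measurable ?M"
  proof (rule borel_measurable_LIMSEQ_real)
    show "(\<lambda>n. (norm (g n s))\<^sup>2) \<longlonglongrightarrow> (norm (blinfun_apply (T (t - s)) h))\<^sup>2" if "s \<in> space ?M" for s
      using lim[of s] that by (intro tendsto_intros) auto
    show "(\<lambda>s. (norm (g n s))\<^sup>2) \<in> borel_measurable ?M" for n
      by (rule borel_measurable_simple_function) (rule simple_function_compose1[OF simple])
  qed
  moreover have fin: "emeasure ?M (space ?M) = t"
    using t by (simp add: emeasure_restrict_space)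
  ultimately have int: "integrable ?M (\<lambda>s. (norm (blinfun_apply (T (t - s)) h))\<^sup>2)"
    using bound by (intro integrableI_bounded_set[where A="space ?M" and B="(kappa T t * norm h)\<^sup>2"])
      (auto intro!: AE_I2)
  show "(\<lambda>s. blinfun_apply (T (t - s)) h) \<in> L2 {0<..<t}" using meas int unfolding L2_def by simp
  have "(LINT s|?M. (norm (blinfun_apply (T (t - s)) h))\<^sup>2) \<le> (LINT s|?M. (kappa T t * norm h)\<^sup>2)"
    using int bound fin by (intro integral_mono finite_measure.integrable_const finite_measureI) auto
  also have "\<dots> = t * (kappa T t * norm h)\<^sup>2"
    using fin t by (simp add: measure_def)
  finally show "(LINT s|?M. (norm (blinfun_apply (T (t - s)) h))\<^sup>2) \<le> t * (kappa T t * norm h)\<^sup>2" .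
qed

section \<open>The smoothing direction\<close>

text \<open>No measurability of the inner product is needed: if it is not integrable, the integral on the left
  is \<open>0\<close>.\<close>

lemma inner_integral_Cauchy_Schwarz:
  assumes f: "integrable M (\<lambda>s. (norm (f s))\<^sup>2)" and g: "integrable M (\<lambda>s. (norm (g s))\<^sup>2)"
  shows "(LINT s|M. inner (f s) (g s))\<^sup>2 \<le> (LINT s|M. (norm (f s))\<^sup>2) * (LINT s|M. (norm (g s))\<^sup>2)"
proof -
  define A where "A = (LINT s|M. (norm (f s))\<^sup>2)"
  define G where "G = (LINT s|M. (norm (g s))\<^sup>2)"
  define X where "X = \<bar>LINT s|M. inner (f s) (g s)\<bar>"
  have A0: "A \<ge> 0" and G0: "G \<ge> 0" and X0: "X \<ge> 0" unfolding A_def G_def X_def by auto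
  have key: "2 * X \<le> l * A + G / l" if l: "l > 0" for l
  proof -
    have "\<bar>inner (f s) (g s)\<bar> \<le> (l * (norm (f s))\<^sup>2 + (norm (g s))\<^sup>2 / l) / 2" for s
    proof -
      have "0 \<le> (l * norm (f s) - norm (g s))\<^sup>2 / l" using l by simp
      then have "norm (f s) * norm (g s) \<le> (l * (norm (f s))\<^sup>2 + (norm (g s))\<^sup>2 / l) / 2"
        using l by (simp add: field_simps power2_eq_square)
      then show ?thesis using Cauchy_Schwarz_ineq2[of "f s" "g s"] by linarith
    qed
    moreover have "0 \<le> (l * (norm (f s))\<^sup>2 + (norm (g s))\<^sup>2 / l) / 2" for s using l by simp
    ultimately have "(LINT s|M. \<bar>inner (f s) (g s)\<bar>) \<le> (LINT s|M. (l * (norm (f s))\<^sup>2 + (norm (g s))\<^sup>2 / l) / 2)"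
      using f g by (intro integral_mono_AE') auto
    also have "\<dots> = (l * A + G / l) / 2" unfolding A_def G_def using f g by simp
    finally have "X \<le> (l * A + G / l) / 2"
      unfolding X_def by (rule order_trans[OF integral_abs_bound])
    then show ?thesis by simp
  qed
  have "X\<^sup>2 \<le> A * G"
  proof (cases "X = 0 \<or> A = 0")
    case False
    with A0 X0 have "X > 0" "A > 0" by auto
    with key[of "X / A"] show ?thesis by (simp add: field_simps power2_eq_square)
  next
    case True
    have "X = 0"
    proof (rule ccontr)
      assume "X \<noteq> 0"
      with True X0 have X: "X > 0" "A = 0" by auto
      then have "0 < G / X + 1" using G0 by (simp add: add_nonneg_pos)
      with key[of "G / X + 1"] X G0 have "2 * X * (G / X + 1) \<le> G" by (simp add: field_simps)
      moreover have "2 * X * (G / X + 1) = 2 * G + 2 * X" using X by (simp add: field_simps)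
      ultimately show False using X G0 by linarith
    qed
    then show ?thesis using A0 G0 by simp
  qed
  then show ?thesis unfolding A_def G_def X_def by simp
qed

text \<open>The vector \<open>S(t) i h\<close> lies in the range of \<open>I\<^sub>t\<close>, being \<open>I\<^sub>t g / t\<close> with
  \<open>g(s) = S\<^sub>H(t - s) h\<close>. The bound is the Cauchy--Schwarz inequality for \<open>g\<close> and the adjoint of \<open>I\<^sub>t\<close>
  at \<open>x'\<close>, whose squared norm is \<open>\<langle>Q x', x'\<rangle>\<close>.\<close>

lemma smoothing_direction_bound:
  fixes S :: "real \<Rightarrow> 'e::banach \<Rightarrow>\<^sub>L 'e" and S_H :: "real \<Rightarrow> 'h::{real_inner,banach} \<Rightarrow>\<^sub>L 'h"
  assumes SH: "C0_semigroup S_H" and comm: "\<And>s. s \<ge> 0 \<Longrightarrow> S s o\<^sub>L i = i o\<^sub>L S_H s"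
    and t: "t > 0" and Q: "is_T_T_adjoint {0<..<t} (I_op S i {0<..<t}) Q"
  shows "(blinfun_apply x' (blinfun_apply (S t) (blinfun_apply i h)))\<^sup>2
           \<le> (kappa S_H t * norm h)\<^sup>2 / t * blinfun_apply x' (Q x')"
proof -
  let ?J = "{0<..<t}"
  let ?T = "I_op S i ?J"
  define v where "v = blinfun_apply (S t) (blinfun_apply i h)"
  define g where "g s = blinfun_apply (S_H (t - s)) h" for s
  have comm': "blinfun_apply (S s) (blinfun_apply i u) = blinfun_apply i (blinfun_apply (S_H s) u)"
    if "s \<ge> 0" for s u
    using comm[OF that] by (metis blinfun_apply_blinfun_compose)
  have "blinfun_apply (S s) (blinfun_apply i (g s)) = v" if "s \<in> ?J" for s
  proof -
    have "S_H t = S_H s o\<^sub>L S_H (t - s)"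
      using SH that unfolding C0_semigroup_def by (metis add.commute diff_add_cancel diff_ge_0_iff_ge greaterThanLessThan_iff less_imp_le)
    then show ?thesis using that t unfolding g_def v_def by (simp add: comm')
  qed
  then have "?T g = integral ?J (\<lambda>s. v)" unfolding I_op_def by (intro integral_cong) auto
  also have "\<dots> = t *\<^sub>R v"
    using has_integral_const_real[of v 0 t] t
    by (intro integral_unique) (simp add: has_integral_Icc_iff_Ioo)
  finally have Tg: "?T g = t *\<^sub>R v" .
  have g: "g \<in> L2 ?J" "(LINT s|lebesgue_on ?J. (norm (g s))\<^sup>2) \<le> t * (kappa S_H t * norm h)\<^sup>2"
    unfolding g_def by (rule reversed_orbit_in_L2[OF SH t])+
  obtain f where f: "L2_adjoint ?J ?T x' f" "Q x' = ?T f" using Q unfolding is_T_T_adjoint_def by blast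
  have fL2: "f \<in> L2 ?J" and adj: "\<And>k. k \<in> L2 ?J \<Longrightarrow> blinfun_apply x' (?T k) = (LINT s|lebesgue_on ?J. inner (f s) (k s))"
    using f(1) unfolding L2_adjoint_def by auto
  have Qx: "blinfun_apply x' (Q x') = (LINT s|lebesgue_on ?J. (norm (f s))\<^sup>2)"
    using adj[OF fL2] f(2) by (simp add: power2_norm_eq_inner)
  have "(t * blinfun_apply x' v)\<^sup>2 = (LINT s|lebesgue_on ?J. inner (f s) (g s))\<^sup>2"
    using adj[OF g(1)] Tg by (simp add: blinfun.bilinear_simps)
  also have "\<dots> \<le> blinfun_apply x' (Q x') * (LINT s|lebesgue_on ?J. (norm (g s))\<^sup>2)"
    unfolding Qx using fL2 g(1) by (intro inner_integral_Cauchy_Schwarz) (auto simp: L2_def)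
  also have "\<dots> \<le> blinfun_apply x' (Q x') * (t * (kappa S_H t * norm h)\<^sup>2)"
    using g(2) by (intro mult_left_mono) (auto simp: Qx)
  finally show ?thesis
    using t unfolding v_def[symmetric] by (simp add: field_simps power2_eq_square)
qed

section \<open>Gaussian measures and their one-dimensional marginals\<close>

lemma std_normal_abs_powr_integrable:
  assumes q: "q \<ge> 0"
  shows "integrable std_normal_distribution (\<lambda>z. \<bar>z\<bar> powr q)"
proof -
  obtain k :: nat where k: "q \<le> real k" using real_arch_simple by blast
  have bound: "\<bar>z\<bar> powr q \<le> 1 + z ^ (2 * k)" for z :: real
  proof (cases "\<bar>z\<bar> \<le> 1")
    case True
    then have "\<bar>z\<bar> powr q \<le> 1" using q by (simp add: powr_le1)
    then show ?thesis by (smt (verit) zero_le_even_power' power_mult zero_le_power2 zero_le_power)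
  next
    case False
    then have "\<bar>z\<bar> powr q \<le> \<bar>z\<bar> powr real (2 * k)" using k by (intro powr_mono) auto
    also have "\<dots> = z ^ (2 * k)" using False by (subst powr_realpow) (auto simp: power_even_abs)
    finally show ?thesis by simp
  qed
  have "integrable std_normal_distribution (\<lambda>z. 1 + z ^ (2 * k))"
  proof -
    interpret real_distribution std_normal_distribution by (rule real_dist_normal_dist)
    show ?thesis using integrable_std_normal_distribution_moment by simp
  qed
  then show ?thesis
  proof (rule Bochner_Integration.integrable_bound)
    show "AE z in std_normal_distribution. norm (\<bar>z\<bar> powr q) \<le> norm (1 + z ^ (2 * k))"
      using bound by (intro AE_I2) (simp add: abs_of_nonneg order_trans[OF powr_ge_zero])
  qed measurable
qed

text \<open>Both kinds of centred Gaussian law on the line, degenerate and normal, are images of the standard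
  normal distribution under a scaling.\<close>

lemma centred_gaussian_real_scaling:
  assumes "centred_gaussian_real \<nu>"
  shows "\<exists>\<sigma>\<ge>0. \<nu> = distr std_normal_distribution borel (\<lambda>z. \<sigma> * z)"
proof -
  interpret N: real_distribution std_normal_distribution by (rule real_dist_normal_dist)
  from assms consider "\<nu> = return borel 0"
    | \<sigma> where "\<sigma> > 0" "\<nu> = density lborel (\<lambda>x. ennreal (normal_density 0 \<sigma> x))"
    unfolding centred_gaussian_real_def by blast
  then show ?thesis
  proof cases
    case 1
    have "distr std_normal_distribution borel (\<lambda>z. 0 * z) = return borel 0"
      by (simp add: N.distr_const)
    with 1 show ?thesis by (intro exI[of _ 0]) simp
  next
    case 2
    have "distributed std_normal_distribution lborel (\<lambda>z. z) std_normal_density"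
      unfolding distributed_def by (auto simp: distr_id2)
    then have "distributed std_normal_distribution lborel (\<lambda>z. 0 + \<sigma> * z) (normal_density (0 + \<sigma> * 0) (\<bar>\<sigma>\<bar> * 1))"
      using 2 by (intro N.normal_density_affine) auto
    then have "distr std_normal_distribution lborel (\<lambda>z. \<sigma> * z) = \<nu>"
      using 2 unfolding distributed_def by simp
    moreover have "distr std_normal_distribution lborel (\<lambda>z. \<sigma> * z) = distr std_normal_distribution borel (\<lambda>z. \<sigma> * z)"
      by (rule distr_cong) auto
    ultimately show ?thesis using 2 by (intro exI[of _ \<sigma>]) auto
  qed
qed

lemma std_normal_cos_sin:
  shows "(LINT z|std_normal_distribution. cos (t * z)) = exp (- t\<^sup>2 / 2)"
    and "(LINT z|std_normal_distribution. sin (t * z)) = 0"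
proof -
  interpret N: real_distribution std_normal_distribution by (rule real_dist_normal_dist)
  have int: "complex_integrable std_normal_distribution (\<lambda>z. iexp (t * z))"
    by (rule N.integrable_iexp) auto
  have eq: "(CLINT z|std_normal_distribution. iexp (t * z)) = complex_of_real (exp (- t\<^sup>2 / 2))"
    using char_std_normal_distribution unfolding char_def by metis
  show "(LINT z|std_normal_distribution. cos (t * z)) = exp (- t\<^sup>2 / 2)"
    using integral_Re[OF int] unfolding eq by (simp add: Re_exp)
  show "(LINT z|std_normal_distribution. sin (t * z)) = 0"
    using integral_Im[OF int] unfolding eq by (simp add: Im_exp)
qed

lemma compact_cube: "compact {v :: nat \<Rightarrow> real. \<forall>n. v n \<in> {-1..1}}"
proof -
  have "compactin (product_topology (\<lambda>_. euclideanreal) UNIV) (Pi\<^sub>E UNIV (\<lambda>_::nat. {-1..1::real}))"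
    by (simp add: compactin_PiE)
  then show ?thesis by (simp add: euclidean_product_topology PiE_def Pi_def)
qed

lemma tendsto_coordinatewise_then_product:
  fixes f :: "'a \<Rightarrow> 'b \<Rightarrow> 'c::topological_space"
  assumes "\<And>i. ((\<lambda>x. f x i) \<longlongrightarrow> l i) F"
  shows "(f \<longlongrightarrow> l) F"
  using limitin_componentwise[of "\<lambda>_. euclidean" UNIV f l F] assms
  by (simp add: euclidean_product_topology)

text \<open>A Borel probability measure on a normed space whose one-dimensional marginals are centred Gaussian,
  with covariance operator \<open>Q\<close>. The covariance of two functionals \<open>\<xi>\<close> and \<open>\<eta>\<close> is \<open>\<eta> (Q \<xi>)\<close>.\<close>

locale gaussian_space = prob_space \<mu>
  for \<mu> :: "'e::real_normed_vector measure" and Q :: "('e \<Rightarrow>\<^sub>L real) \<Rightarrow> 'e" +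
  assumes sets_borel: "sets \<mu> = sets borel"
    and gaussian: "\<And>x' :: 'e \<Rightarrow>\<^sub>L real. centred_gaussian_real (distr \<mu> borel (blinfun_apply x'))"
    and covariance: "covariance_operator \<mu> Q"
begin

lemma continuous_measurable [measurable_dest]:
  "continuous_on UNIV F \<Longrightarrow> F \<in> borel_measurable \<mu>"
  using borel_measurable_continuous_onI[of F] measurable_cong_sets[OF sets_borel refl] by auto

lemma functional_measurable [measurable]: "blinfun_apply x' \<in> borel_measurable \<mu>"
  by (intro continuous_measurable continuous_intros)

lemma covariance_eq: "blinfun_apply y' (Q x') = (LINT y|\<mu>. blinfun_apply x' y * blinfun_apply y' y)"
  using covariance unfolding covariance_operator_def by blast

lemma covariance_commute: "blinfun_apply y' (Q x') = blinfun_apply x' (Q y')"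
  unfolding covariance_eq by (simp add: mult.commute)

lemma law:
  "distr \<mu> borel (blinfun_apply x') = distr std_normal_distribution borel (\<lambda>z. sqrt (blinfun_apply x' (Q x')) * z)"
proof -
  obtain \<sigma> where \<sigma>: "\<sigma> \<ge> 0" "distr \<mu> borel (blinfun_apply x') = distr std_normal_distribution borel (\<lambda>z. \<sigma> * z)"
    using centred_gaussian_real_scaling[OF gaussian] by blast
  have "blinfun_apply x' (Q x') = (LINT x|distr \<mu> borel (blinfun_apply x'). x\<^sup>2)"
    unfolding covariance_eq by (subst integral_distr) (auto simp: power2_eq_square)
  also have "\<dots> = (LINT z|std_normal_distribution. (\<sigma> * z)\<^sup>2)"
    unfolding \<sigma>(2) by (subst integral_distr) auto
  also have "\<dots> = \<sigma>\<^sup>2"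
    using std_normal_distribution_even_moments(1)[of 1] by (simp add: power_mult_distrib)
  finally show ?thesis using \<sigma> by simp
qed

lemma variance_nonneg: "blinfun_apply x' (Q x') \<ge> 0"
  unfolding covariance_eq by (simp flip: power2_eq_square)

lemma functional_integral:
  fixes G :: "real \<Rightarrow> real"
  assumes [measurable]: "G \<in> borel_measurable borel"
  shows "(LINT y|\<mu>. G (blinfun_apply x' y))
    = (LINT z|std_normal_distribution. G (sqrt (blinfun_apply x' (Q x')) * z))"
proof -
  have "(LINT y|\<mu>. G (blinfun_apply x' y)) = (LINT x|distr \<mu> borel (blinfun_apply x'). G x)"
    by (subst integral_distr) auto
  also have "\<dots> = (LINT z|std_normal_distribution. G (sqrt (blinfun_apply x' (Q x')) * z))"
    unfolding law by (subst integral_distr) auto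
  finally show ?thesis .
qed

lemma functional_integrable:
  fixes G :: "real \<Rightarrow> real"
  assumes [measurable]: "G \<in> borel_measurable borel"
    and "integrable std_normal_distribution (\<lambda>z. G (sqrt (blinfun_apply x' (Q x')) * z))"
  shows "integrable \<mu> (\<lambda>y. G (blinfun_apply x' y))"
proof -
  have "integrable (distr \<mu> borel (blinfun_apply x')) G"
    unfolding law using assms by (subst integrable_distr_eq) auto
  then show ?thesis by (subst (asm) integrable_distr_eq) auto
qed

lemma absolute_moment:
  assumes q: "q \<ge> 0"
  shows "integrable \<mu> (\<lambda>y. \<bar>blinfun_apply x' y\<bar> powr q)"
    and "(LINT y|\<mu>. \<bar>blinfun_apply x' y\<bar> powr q)
      = sqrt (blinfun_apply x' (Q x')) powr q * (LINT z|std_normal_distribution. \<bar>z\<bar> powr q)"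
proof -
  have eq: "\<bar>sqrt (blinfun_apply x' (Q x')) * z\<bar> powr q = sqrt (blinfun_apply x' (Q x')) powr q * \<bar>z\<bar> powr q" for z
    using variance_nonneg[of x'] by (simp add: abs_mult powr_mult)
  show "integrable \<mu> (\<lambda>y. \<bar>blinfun_apply x' y\<bar> powr q)"
    using std_normal_abs_powr_integrable[OF q] by (intro functional_integrable) (auto simp: eq)
  show "(LINT y|\<mu>. \<bar>blinfun_apply x' y\<bar> powr q)
      = sqrt (blinfun_apply x' (Q x')) powr q * (LINT z|std_normal_distribution. \<bar>z\<bar> powr q)"
    by (subst functional_integral) (auto simp: eq)
qed

lemma functional_integrable1:
  fixes x' :: "'e \<Rightarrow>\<^sub>L real"
  shows "integrable \<mu> (blinfun_apply x')"
  using absolute_moment(1)[of 1 x'] by (simp add: integrable_abs_iff)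

lemma cos_sin_integral:
  fixes x' :: "'e \<Rightarrow>\<^sub>L real"
  shows "(LINT y|\<mu>. cos (blinfun_apply x' y)) = exp (- blinfun_apply x' (Q x') / 2)"
    and "(LINT y|\<mu>. sin (blinfun_apply x' y)) = 0"
  using functional_integral[of cos x'] functional_integral[of sin x'] variance_nonneg[of x']
  by (simp_all add: std_normal_cos_sin)

lemma variance_pencil:
  "blinfun_apply (\<eta> + s *\<^sub>R \<xi>) (Q (\<eta> + s *\<^sub>R \<xi>))
     = blinfun_apply \<eta> (Q \<eta>) + 2 * s * blinfun_apply \<eta> (Q \<xi>) + s\<^sup>2 * blinfun_apply \<xi> (Q \<xi>)"
proof -
  have "blinfun_apply (\<eta> + s *\<^sub>R \<xi>) (Q (\<eta> + s *\<^sub>R \<xi>))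
    = blinfun_apply \<eta> (Q (\<eta> + s *\<^sub>R \<xi>)) + s * blinfun_apply \<xi> (Q (\<eta> + s *\<^sub>R \<xi>))"
    by (simp add: blinfun.bilinear_simps)
  also have "\<dots> = blinfun_apply (\<eta> + s *\<^sub>R \<xi>) (Q \<eta>) + s * blinfun_apply (\<eta> + s *\<^sub>R \<xi>) (Q \<xi>)"
    by (simp only: covariance_commute)
  also have "\<dots> = blinfun_apply \<eta> (Q \<eta>) + 2 * s * blinfun_apply \<eta> (Q \<xi>) + s\<^sup>2 * blinfun_apply \<xi> (Q \<xi>)"
    using covariance_commute[of \<xi> \<eta>]
    by (simp add: blinfun.bilinear_simps algebra_simps power2_eq_square)
  finally show ?thesis .
qed

text \<open>The joint law of \<open>\<xi>\<close> and \<open>\<eta>\<close> enters only through the marginals along \<open>\<eta> + s \<xi>\<close>: the integrals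
  of \<open>sin (\<eta> + s \<xi>)\<close> and \<open>cos (\<eta> + s \<xi>)\<close> are explicit functions of \<open>s\<close>, to be differentiated at
  \<open>s = 0\<close>.\<close>

lemma weighted_cos_sin_integral:
  shows "(LINT y|\<mu>. blinfun_apply \<xi> y * cos (blinfun_apply \<eta> y)) = 0"
    and "(LINT y|\<mu>. blinfun_apply \<xi> y * sin (blinfun_apply \<eta> y))
       = blinfun_apply \<eta> (Q \<xi>) * exp (- blinfun_apply \<eta> (Q \<eta>) / 2)"
proof -
  have pencil: "blinfun_apply (\<eta> + s *\<^sub>R \<xi>) y = blinfun_apply \<eta> y + s * blinfun_apply \<xi> y" for s y
    by (simp add: blinfun.bilinear_simps)
  have intK: "integrable \<mu> (\<lambda>y. \<bar>blinfun_apply \<xi> y\<bar>)"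
    by (intro integrable_abs functional_integrable1)
  have "((\<lambda>s. LINT y|\<mu>. sin (blinfun_apply \<eta> y + s * blinfun_apply \<xi> y)) has_real_derivative
      (LINT y|\<mu>. cos (blinfun_apply \<eta> y + 0 * blinfun_apply \<xi> y) * blinfun_apply \<xi> y)) (at 0)"
    by (rule has_real_derivative_integral[OF _ _ _ _ intK])
      (auto intro!: derivative_eq_intros integrable_const_bound[where B=1] simp: abs_mult mult_left_le_one_le)
  moreover have "(LINT y|\<mu>. sin (blinfun_apply \<eta> y + s * blinfun_apply \<xi> y)) = 0" for s
    using cos_sin_integral(2)[of "\<eta> + s *\<^sub>R \<xi>"] by (simp add: pencil)
  ultimately show "(LINT y|\<mu>. blinfun_apply \<xi> y * cos (blinfun_apply \<eta> y)) = 0"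
    using DERIV_unique[OF _ DERIV_const] by (fastforce simp: mult.commute)
  have "((\<lambda>s. LINT y|\<mu>. cos (blinfun_apply \<eta> y + s * blinfun_apply \<xi> y)) has_real_derivative
      (LINT y|\<mu>. - sin (blinfun_apply \<eta> y + 0 * blinfun_apply \<xi> y) * blinfun_apply \<xi> y)) (at 0)"
    by (rule has_real_derivative_integral[OF _ _ _ _ intK])
      (auto intro!: derivative_eq_intros integrable_const_bound[where B=1] simp: abs_mult mult_left_le_one_le)
  moreover have "(LINT y|\<mu>. cos (blinfun_apply \<eta> y + s * blinfun_apply \<xi> y))
      = exp (- (blinfun_apply \<eta> (Q \<eta>) + 2 * s * blinfun_apply \<eta> (Q \<xi>) + s\<^sup>2 * blinfun_apply \<xi> (Q \<xi>)) / 2)" for s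
    using cos_sin_integral(1)[of "\<eta> + s *\<^sub>R \<xi>"] unfolding variance_pencil by (simp add: pencil)
  moreover have "((\<lambda>s. exp (- (blinfun_apply \<eta> (Q \<eta>) + 2 * s * blinfun_apply \<eta> (Q \<xi>) + s\<^sup>2 * blinfun_apply \<xi> (Q \<xi>)) / 2))
      has_real_derivative - (blinfun_apply \<eta> (Q \<xi>) * exp (- blinfun_apply \<eta> (Q \<eta>) / 2))) (at 0)"
    by (auto intro!: derivative_eq_intros)
  ultimately have "(LINT y|\<mu>. - sin (blinfun_apply \<eta> y + 0 * blinfun_apply \<xi> y) * blinfun_apply \<xi> y)
     = - (blinfun_apply \<eta> (Q \<xi>) * exp (- blinfun_apply \<eta> (Q \<eta>) / 2))"
    using DERIV_unique by fastforce
  then show "(LINT y|\<mu>. blinfun_apply \<xi> y * sin (blinfun_apply \<eta> y))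
       = blinfun_apply \<eta> (Q \<xi>) * exp (- blinfun_apply \<eta> (Q \<eta>) / 2)"
    by (simp add: mult.commute)
qed

section \<open>Translation along the covariance: trigonometric functions\<close>

text \<open>The integrated form of Gaussian integration by parts: the derivative of \<open>r \<mapsto> E F(Y + r Q \<xi>)\<close> is
  \<open>E \<xi>(Y) F(Y + r Q \<xi>)\<close>. No derivative of \<open>F\<close> occurs, so the identity survives bounded pointwise
  limits. The outer integral is a Henstock--Kurzweil integral, for which the dominated convergence
  theorem needs no separate measurability in \<open>u\<close>.\<close>

definition translation_identity :: "('e \<Rightarrow>\<^sub>L real) \<Rightarrow> ('e \<Rightarrow> real) \<Rightarrow> bool" where
  "translation_identity \<xi> F \<longleftrightarrow> (\<forall>r\<ge>0. ((\<lambda>u. LINT y|\<mu>. blinfun_apply \<xi> y * F (y + u *\<^sub>R Q \<xi>)) has_integral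
     ((LINT y|\<mu>. F (y + r *\<^sub>R Q \<xi>)) - (LINT y|\<mu>. F y))) {0..r})"

lemma bounded_continuous_integrable:
  fixes F :: "'e \<Rightarrow> real"
  assumes F: "continuous_on UNIV F" "bounded (range F)"
  shows "integrable \<mu> (\<lambda>y. F (y + c))"
    and "integrable \<mu> (\<lambda>y. blinfun_apply \<xi> y * F (y + c))"
proof -
  obtain K where K: "\<And>y. \<bar>F y\<bar> \<le> K" using F(2) unfolding bounded_iff by auto
  have "continuous_on UNIV (\<lambda>y. F (y + c))"
    by (rule continuous_on_compose2[OF F(1)]) (auto intro!: continuous_intros)
  then have [measurable]: "(\<lambda>y. F (y + c)) \<in> borel_measurable \<mu>" by (rule continuous_measurable)
  show "integrable \<mu> (\<lambda>y. F (y + c))"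
    using K by (intro integrable_const_bound[where B=K]) auto
  show "integrable \<mu> (\<lambda>y. blinfun_apply \<xi> y * F (y + c))"
  proof (rule Bochner_Integration.integrable_bound)
    show "integrable \<mu> (\<lambda>y. K * blinfun_apply \<xi> y)"
      by (intro Bochner_Integration.integrable_mult_right functional_integrable1)
    show "AE y in \<mu>. norm (blinfun_apply \<xi> y * F (y + c)) \<le> norm (K * blinfun_apply \<xi> y)"
    proof (rule AE_I2)
      fix y
      have "\<bar>blinfun_apply \<xi> y\<bar> * \<bar>F (y + c)\<bar> \<le> \<bar>blinfun_apply \<xi> y\<bar> * \<bar>K\<bar>"
        using K[of "y + c"] by (intro mult_left_mono) auto
      then show "norm (blinfun_apply \<xi> y * F (y + c)) \<le> norm (K * blinfun_apply \<xi> y)"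
        by (simp add: abs_mult mult.commute)
    qed
  qed measurable
qed

lemma translation_identity_add:
  assumes "continuous_on UNIV F" "bounded (range F)" "continuous_on UNIV G" "bounded (range G)"
    and "translation_identity \<xi> F" "translation_identity \<xi> G"
  shows "translation_identity \<xi> (\<lambda>y. F y + G y)"
  unfolding translation_identity_def
proof (intro allI impI)
  fix r :: real assume "r \<ge> 0"
  then have "((\<lambda>u. (LINT y|\<mu>. blinfun_apply \<xi> y * F (y + u *\<^sub>R Q \<xi>)) + (LINT y|\<mu>. blinfun_apply \<xi> y * G (y + u *\<^sub>R Q \<xi>)))
    has_integral (((LINT y|\<mu>. F (y + r *\<^sub>R Q \<xi>)) - (LINT y|\<mu>. F y)) + ((LINT y|\<mu>. G (y + r *\<^sub>R Q \<xi>)) - (LINT y|\<mu>. G y)))) {0..r}"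
    using assms(5,6) unfolding translation_identity_def by (intro has_integral_add) auto
  moreover note iF = bounded_continuous_integrable[OF assms(1,2)] and iG = bounded_continuous_integrable[OF assms(3,4)]
  have "(LINT y|\<mu>. F (y + c) + G (y + c)) = (LINT y|\<mu>. F (y + c)) + (LINT y|\<mu>. G (y + c))" for c
    by (rule Bochner_Integration.integral_add[OF iF(1) iG(1)])
  note this[of "r *\<^sub>R Q \<xi>"] this[of 0]
  moreover have "(LINT y|\<mu>. blinfun_apply \<xi> y * (F (y + c) + G (y + c)))
      = (LINT y|\<mu>. blinfun_apply \<xi> y * F (y + c)) + (LINT y|\<mu>. blinfun_apply \<xi> y * G (y + c))" for c
    unfolding distrib_left by (rule Bochner_Integration.integral_add[OF iF(2) iG(2)])
  ultimately show "((\<lambda>u. LINT y|\<mu>. blinfun_apply \<xi> y * (F (y + u *\<^sub>R Q \<xi>) + G (y + u *\<^sub>R Q \<xi>))) has_integral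
     ((LINT y|\<mu>. F (y + r *\<^sub>R Q \<xi>) + G (y + r *\<^sub>R Q \<xi>)) - (LINT y|\<mu>. F y + G y))) {0..r}"
    by (simp add: add_diff_add)
qed

lemma translation_identity_cmult:
  assumes "translation_identity \<xi> F"
  shows "translation_identity \<xi> (\<lambda>y. c * F y)"
  unfolding translation_identity_def
proof (intro allI impI)
  fix r :: real assume "r \<ge> 0"
  then have "((\<lambda>u. c * (LINT y|\<mu>. blinfun_apply \<xi> y * F (y + u *\<^sub>R Q \<xi>))) has_integral
    c * ((LINT y|\<mu>. F (y + r *\<^sub>R Q \<xi>)) - (LINT y|\<mu>. F y))) {0..r}"
    using assms unfolding translation_identity_def by (intro has_integral_mult_right) auto
  then show "((\<lambda>u. LINT y|\<mu>. blinfun_apply \<xi> y * (c * F (y + u *\<^sub>R Q \<xi>))) has_integral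
     ((LINT y|\<mu>. c * F (y + r *\<^sub>R Q \<xi>)) - (LINT y|\<mu>. c * F y))) {0..r}"
    by (simp add: mult.left_commute[of _ c] right_diff_distrib)
qed

lemma translation_identity_limit:
  assumes F: "\<And>n. continuous_on UNIV (F n)" "\<And>n y. \<bar>F n y\<bar> \<le> K" "\<And>n. translation_identity \<xi> (F n)"
    and lim: "\<And>y. (\<lambda>n. F n y) \<longlonglongrightarrow> G y"
  shows "translation_identity \<xi> G"
  unfolding translation_identity_def
proof (intro allI impI)
  fix r :: real assume r: "r \<ge> 0"
  have bF: "bounded (range (F n))" for n unfolding bounded_iff using F(2) by auto
  note int = bounded_continuous_integrable[OF F(1) bF]
  have G_meas: "(\<lambda>y. G (y + c)) \<in> borel_measurable \<mu>" for c
    by (rule borel_measurable_LIMSEQ_real[where u="\<lambda>n y. F n (y + c)"],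
        rule lim, rule borel_measurable_integrable[OF int(1)])
  have lim0: "(\<lambda>n. LINT y|\<mu>. F n (y + c)) \<longlonglongrightarrow> (LINT y|\<mu>. G (y + c))" for c
    by (rule integral_dominated_convergence[where w="\<lambda>_. K"])
      (simp_all add: lim G_meas borel_measurable_integrable[OF int(1)] F(2))
  have wK: "integrable \<mu> (\<lambda>y. \<bar>blinfun_apply \<xi> y\<bar> * K)"
    by (intro Bochner_Integration.integrable_mult_left integrable_abs functional_integrable1)
  have lim1: "(\<lambda>n. LINT y|\<mu>. blinfun_apply \<xi> y * F n (y + u *\<^sub>R Q \<xi>)) \<longlonglongrightarrow> (LINT y|\<mu>. blinfun_apply \<xi> y * G (y + u *\<^sub>R Q \<xi>))" for u
    by (rule integral_dominated_convergence[where w="\<lambda>y. \<bar>blinfun_apply \<xi> y\<bar> * K"])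
      (simp_all add: functional_integrable1 lim G_meas functional_measurable borel_measurable_times
         borel_measurable_integrable[OF int(2)] F(2) tendsto_mult_left abs_mult mult_left_mono)
  have hi: "((\<lambda>u. LINT y|\<mu>. blinfun_apply \<xi> y * F n (y + u *\<^sub>R Q \<xi>)) has_integral
     ((LINT y|\<mu>. F n (y + r *\<^sub>R Q \<xi>)) - (LINT y|\<mu>. F n y))) {0..r}" for n
    using F(3) r unfolding translation_identity_def by blast
  have bd: "norm (LINT y|\<mu>. blinfun_apply \<xi> y * F n (y + u *\<^sub>R Q \<xi>)) \<le> (LINT y|\<mu>. \<bar>blinfun_apply \<xi> y\<bar> * K)" for n u
  proof (rule order_trans[OF integral_norm_bound], rule integral_mono[OF integrable_norm[OF int(2)] wK])
    show "norm (blinfun_apply \<xi> y * F n (y + u *\<^sub>R Q \<xi>)) \<le> \<bar>blinfun_apply \<xi> y\<bar> * K" for y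
      using F(2) by (simp add: abs_mult mult_left_mono)
  qed
  have intG: "(\<lambda>u. LINT y|\<mu>. blinfun_apply \<xi> y * G (y + u *\<^sub>R Q \<xi>)) integrable_on {0..r}"
    and limG: "(\<lambda>n. integral {0..r} (\<lambda>u. LINT y|\<mu>. blinfun_apply \<xi> y * F n (y + u *\<^sub>R Q \<xi>))) \<longlonglongrightarrow>
      integral {0..r} (\<lambda>u. LINT y|\<mu>. blinfun_apply \<xi> y * G (y + u *\<^sub>R Q \<xi>))"
    using dominated_convergence[where S="{0..r}" and h="\<lambda>_. LINT y|\<mu>. \<bar>blinfun_apply \<xi> y\<bar> * K"
        and f="\<lambda>n u. LINT y|\<mu>. blinfun_apply \<xi> y * F n (y + u *\<^sub>R Q \<xi>)"
        and g="\<lambda>u. LINT y|\<mu>. blinfun_apply \<xi> y * G (y + u *\<^sub>R Q \<xi>)"]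
      has_integral_integrable[OF hi] bd lim1 by auto
  have "(\<lambda>n. (LINT y|\<mu>. F n (y + r *\<^sub>R Q \<xi>)) - (LINT y|\<mu>. F n y)) \<longlonglongrightarrow> (LINT y|\<mu>. G (y + r *\<^sub>R Q \<xi>)) - (LINT y|\<mu>. G y)"
    using tendsto_diff[OF lim0[of "r *\<^sub>R Q \<xi>"] lim0[of 0]] by simp
  from LIMSEQ_unique[OF limG[unfolded integral_unique[OF hi]] this] intG
  show "((\<lambda>u. LINT y|\<mu>. blinfun_apply \<xi> y * G (y + u *\<^sub>R Q \<xi>)) has_integral
     ((LINT y|\<mu>. G (y + r *\<^sub>R Q \<xi>)) - (LINT y|\<mu>. G y))) {0..r}"
    by (simp add: has_integral_integral)
qed

lemma translation_identity_sin_cos: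
  shows "translation_identity \<xi> (\<lambda>y. sin (blinfun_apply \<eta> y))" and "translation_identity \<xi> (\<lambda>y. cos (blinfun_apply \<eta> y))"
proof -
  define c where "c = blinfun_apply \<eta> (Q \<xi>)"
  define E where "E = exp (- blinfun_apply \<eta> (Q \<eta>) / 2)"
  have shift: "blinfun_apply \<eta> (y + u *\<^sub>R Q \<xi>) = blinfun_apply \<eta> y + u * c" for y u
    unfolding c_def by (simp add: blinfun.bilinear_simps)
  have cs: "continuous_on UNIV (\<lambda>y. cos (blinfun_apply \<eta> y))" "continuous_on UNIV (\<lambda>y. sin (blinfun_apply \<eta> y))"
    by (intro continuous_intros)+
  have b: "bounded (range (\<lambda>y. cos (blinfun_apply \<eta> y)))" "bounded (range (\<lambda>y. sin (blinfun_apply \<eta> y)))"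
    unfolding bounded_iff by (auto intro!: exI[of _ 1])
  note ints = bounded_continuous_integrable[OF cs(1) b(1), where c=0, simplified]
    bounded_continuous_integrable[OF cs(2) b(2), where c=0, simplified]
  have w1: "(LINT y|\<mu>. blinfun_apply \<xi> y * sin (blinfun_apply \<eta> y + u * c)) = c * E * cos (u * c)" for u
  proof -
    have "blinfun_apply \<xi> y * sin (blinfun_apply \<eta> y + u * c)
      = blinfun_apply \<xi> y * sin (blinfun_apply \<eta> y) * cos (u * c) + blinfun_apply \<xi> y * cos (blinfun_apply \<eta> y) * sin (u * c)" for y
      by (simp add: sin_add algebra_simps)
    then show ?thesis using ints by (simp add: weighted_cos_sin_integral c_def E_def)
  qed
  have w2: "(LINT y|\<mu>. blinfun_apply \<xi> y * cos (blinfun_apply \<eta> y + u * c)) = - (c * E * sin (u * c))" for u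
  proof -
    have "blinfun_apply \<xi> y * cos (blinfun_apply \<eta> y + u * c)
      = blinfun_apply \<xi> y * cos (blinfun_apply \<eta> y) * cos (u * c) - blinfun_apply \<xi> y * sin (blinfun_apply \<eta> y) * sin (u * c)" for y
      by (simp add: cos_add algebra_simps)
    then show ?thesis using ints by (simp add: weighted_cos_sin_integral c_def E_def)
  qed
  have e1: "(LINT y|\<mu>. sin (blinfun_apply \<eta> y + u * c)) = E * sin (u * c)" for u
    using ints by (simp add: sin_add cos_sin_integral E_def)
  have e2: "(LINT y|\<mu>. cos (blinfun_apply \<eta> y + u * c)) = E * cos (u * c)" for u
    using ints by (simp add: cos_add cos_sin_integral E_def)
  have "((\<lambda>u. c * E * cos (u * c)) has_integral E * sin (r * c) - E * sin (0 * c)) {0..r}" if "r \<ge> 0" for r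
    using that by (intro fundamental_theorem_of_calculus)
      (auto intro!: derivative_eq_intros simp: has_real_derivative_iff_has_vector_derivative[symmetric])
  then show "translation_identity \<xi> (\<lambda>y. sin (blinfun_apply \<eta> y))"
    unfolding translation_identity_def shift w1 e1 by (simp add: cos_sin_integral E_def)
  have "((\<lambda>u. - (c * E * sin (u * c))) has_integral E * cos (r * c) - E * cos (0 * c)) {0..r}" if "r \<ge> 0" for r
    using that by (intro fundamental_theorem_of_calculus)
      (auto intro!: derivative_eq_intros simp: has_real_derivative_iff_has_vector_derivative[symmetric])
  then show "translation_identity \<xi> (\<lambda>y. cos (blinfun_apply \<eta> y))"
    unfolding translation_identity_def shift w2 e2 by (simp add: cos_sin_integral E_def)
qed

text \<open>The bounded continuous functions whose products with all \<open>cos \<eta>\<close> and \<open>sin \<eta>\<close> satisfy the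
  translation identity. By the addition theorems this class is closed under multiplication by sines,
  which the translation identity alone does not provide; with \<open>\<eta> = 0\<close> it implies that identity.\<close>

definition trig_stable_identity :: "('e \<Rightarrow>\<^sub>L real) \<Rightarrow> ('e \<Rightarrow> real) \<Rightarrow> bool" where
  "trig_stable_identity \<xi> F \<longleftrightarrow> continuous_on UNIV F \<and> bounded (range F) \<and>
     (\<forall>\<eta>. translation_identity \<xi> (\<lambda>y. F y * cos (blinfun_apply \<eta> y)) \<and> translation_identity \<xi> (\<lambda>y. F y * sin (blinfun_apply \<eta> y)))"

lemma bounded_range_mult_trig:
  fixes F :: "'e \<Rightarrow> real"
  assumes "bounded (range F)"
  shows "bounded (range (\<lambda>y. F y * cos (g y)))" "bounded (range (\<lambda>y. F y * sin (g y)))"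
proof -
  obtain K where K: "\<And>y. \<bar>F y\<bar> \<le> K" using assms unfolding bounded_iff by auto
  have "\<bar>F y * cos (g y)\<bar> \<le> K" "\<bar>F y * sin (g y)\<bar> \<le> K" for y
    using mult_mono[OF K[of y] abs_cos_le_one[of "g y"]] mult_mono[OF K[of y] abs_sin_le_one[of "g y"]]
      order_trans[OF abs_ge_zero K[of y]] by (auto simp: abs_mult)
  then show "bounded (range (\<lambda>y. F y * cos (g y)))" "bounded (range (\<lambda>y. F y * sin (g y)))"
    unfolding bounded_iff by auto
qed

lemma trig_stable_identity_one: "trig_stable_identity \<xi> (\<lambda>_. 1)"
  unfolding trig_stable_identity_def using translation_identity_sin_cos by (auto simp: bounded_iff)

lemma trig_stable_identity_add:
  assumes F: "trig_stable_identity \<xi> F" and G: "trig_stable_identity \<xi> G"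
  shows "trig_stable_identity \<xi> (\<lambda>y. F y + G y)"
  unfolding trig_stable_identity_def
proof (intro conjI allI)
  note F' = F[unfolded trig_stable_identity_def] and G' = G[unfolded trig_stable_identity_def]
  show "continuous_on UNIV (\<lambda>y. F y + G y)" using F' G' by (intro continuous_intros) auto
  show "bounded (range (\<lambda>y. F y + G y))" using F' G' by (intro bounded_plus_comp) auto
  fix \<eta> :: "'e \<Rightarrow>\<^sub>L real"
  show "translation_identity \<xi> (\<lambda>y. (F y + G y) * cos (blinfun_apply \<eta> y))"
    unfolding distrib_right using F' G' by (intro translation_identity_add bounded_range_mult_trig continuous_intros) auto
  show "translation_identity \<xi> (\<lambda>y. (F y + G y) * sin (blinfun_apply \<eta> y))"
    unfolding distrib_right using F' G' by (intro translation_identity_add bounded_range_mult_trig continuous_intros) auto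
qed

lemma trig_stable_identity_cmult:
  assumes F: "trig_stable_identity \<xi> F"
  shows "trig_stable_identity \<xi> (\<lambda>y. F y * c)"
  unfolding trig_stable_identity_def
proof (intro conjI allI)
  note F' = F[unfolded trig_stable_identity_def]
  show "continuous_on UNIV (\<lambda>y. F y * c)" using F' by (intro continuous_intros) auto
  show "bounded (range (\<lambda>y. F y * c))" using F' bounded_scaling[of "range F" c]
    by (auto simp: image_image mult.commute)
  show "translation_identity \<xi> (\<lambda>y. F y * c * cos (blinfun_apply \<eta> y))" for \<eta>
    using translation_identity_cmult[of \<xi> "\<lambda>y. F y * cos (blinfun_apply \<eta> y)" c] F' by (simp add: mult_ac)
  show "translation_identity \<xi> (\<lambda>y. F y * c * sin (blinfun_apply \<eta> y))" for \<eta>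
    using translation_identity_cmult[of \<xi> "\<lambda>y. F y * sin (blinfun_apply \<eta> y)" c] F' by (simp add: mult_ac)
qed

lemma trig_stable_identity_sin:
  assumes F: "trig_stable_identity \<xi> F"
  shows "trig_stable_identity \<xi> (\<lambda>y. F y * sin (blinfun_apply \<zeta> y))"
  unfolding trig_stable_identity_def
proof (intro conjI allI)
  note F' = F[unfolded trig_stable_identity_def]
  show "continuous_on UNIV (\<lambda>y. F y * sin (blinfun_apply \<zeta> y))" using F' by (intro continuous_intros) auto
  show "bounded (range (\<lambda>y. F y * sin (blinfun_apply \<zeta> y)))" using F' by (intro bounded_range_mult_trig) auto
  fix \<eta> :: "'e \<Rightarrow>\<^sub>L real"
  have half: "translation_identity \<xi> (\<lambda>y. c * (F y * sin (blinfun_apply \<theta> y)))" "translation_identity \<xi> (\<lambda>y. c * (F y * cos (blinfun_apply \<theta> y)))"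
    for c :: real and \<theta> :: "'e \<Rightarrow>\<^sub>L real"
    using F' by (auto intro!: translation_identity_cmult simp only:)
  have pm: "continuous_on UNIV (\<lambda>y. c * (F y * sin (blinfun_apply \<theta> y)))"
    "continuous_on UNIV (\<lambda>y. c * (F y * cos (blinfun_apply \<theta> y)))"
    "bounded (range (\<lambda>y. c * (F y * sin (blinfun_apply \<theta> y))))"
    "bounded (range (\<lambda>y. c * (F y * cos (blinfun_apply \<theta> y))))"
    for c :: real and \<theta> :: "'e \<Rightarrow>\<^sub>L real"
    using F' bounded_range_mult_trig[of "\<lambda>y. c * F y"] bounded_scaling[of "range F" c]
    by (auto intro!: continuous_intros simp: image_image mult.assoc[symmetric])
  have "F y * sin (blinfun_apply \<zeta> y) * cos (blinfun_apply \<eta> y)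
      = (1/2) * (F y * sin (blinfun_apply (\<zeta> + \<eta>) y)) + (1/2) * (F y * sin (blinfun_apply (\<zeta> - \<eta>) y))" for y
    by (simp add: blinfun.bilinear_simps sin_add sin_diff algebra_simps)
  then show "translation_identity \<xi> (\<lambda>y. F y * sin (blinfun_apply \<zeta> y) * cos (blinfun_apply \<eta> y))"
    using translation_identity_add[OF pm(1,3) pm(1,3) half(1) half(1)] by presburger
  have "F y * sin (blinfun_apply \<zeta> y) * sin (blinfun_apply \<eta> y)
      = (- 1/2) * (F y * cos (blinfun_apply (\<zeta> + \<eta>) y)) + (1/2) * (F y * cos (blinfun_apply (\<zeta> - \<eta>) y))" for y
    by (simp add: blinfun.bilinear_simps cos_add cos_diff algebra_simps)
  then show "translation_identity \<xi> (\<lambda>y. F y * sin (blinfun_apply \<zeta> y) * sin (blinfun_apply \<eta> y))"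
    using translation_identity_add[OF pm(2,4) pm(2,4) half(2) half(2)] by presburger
qed

section \<open>Translation along the covariance: cylindrical functions\<close>

text \<open>Stone--Weierstrass on the infinite-dimensional cube, applied to the functions \<open>R\<close> for which
  multiplication by \<open>R (sin x'\<^sub>0, sin x'\<^sub>1, \<dots>)\<close> preserves the class above. Stated in this way, closure
  under products is immediate.\<close>

lemma translation_identity_sin_vector:
  fixes x' :: "nat \<Rightarrow> 'e \<Rightarrow>\<^sub>L real"
  assumes \<psi>: "continuous_on {v. \<forall>n. v n \<in> {-1..1}} \<psi>" and K: "\<And>v. \<bar>\<psi> v\<bar> \<le> K"
  shows "translation_identity \<xi> (\<lambda>y. \<psi> (\<lambda>n. sin (blinfun_apply (x' n) y)))"
proof -
  let ?S = "{v :: nat \<Rightarrow> real. \<forall>n. v n \<in> {-1..1}}"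
  let ?s = "\<lambda>y n. sin (blinfun_apply (x' n) y)"
  define P where "P R \<longleftrightarrow> continuous_on UNIV R \<and> (\<forall>F. trig_stable_identity \<xi> F \<longrightarrow> trig_stable_identity \<xi> (\<lambda>y. F y * R (?s y)))"
    for R :: "(nat \<Rightarrow> real) \<Rightarrow> real"
  have "\<exists>R. P R \<and> (\<forall>v\<in>?S. \<bar>\<psi> v - R v\<bar> < e)" if e: "e > 0" for e
  proof (rule Stone_Weierstrass_HOL[OF compact_cube _ _ _ _ _ \<psi> e])
    show "P (\<lambda>_. c)" for c unfolding P_def by (auto intro: trig_stable_identity_cmult)
    show "continuous_on ?S R" if "P R" for R
      using that unfolding P_def by (auto intro: continuous_on_subset)
    show "P (\<lambda>v. R v + R' v)" if "P R \<and> P R'" for R R'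
      using that unfolding P_def distrib_left by (auto intro!: trig_stable_identity_add continuous_intros)
    show "P (\<lambda>v. R v * R' v)" if "P R \<and> P R'" for R R'
      using that unfolding P_def by (auto intro!: continuous_intros simp flip: mult.assoc)
    have coord: "P (\<lambda>v. v n)" for n
      unfolding P_def by (auto intro: trig_stable_identity_sin continuous_on_product_coordinates)
    show "\<exists>R. P R \<and> R v \<noteq> R w" if "v \<in> ?S \<and> w \<in> ?S \<and> v \<noteq> w" for v w
      using that coord by (metis ext)
  qed
  then have "\<exists>R. P R \<and> (\<forall>v\<in>?S. \<bar>\<psi> v - R v\<bar> < 1 / (real k + 1))" for k by simp
  then obtain R where R: "\<And>k. P (R k)" "\<And>k v. v \<in> ?S \<Longrightarrow> \<bar>\<psi> v - R k v\<bar> < 1 / (real k + 1)"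
    by metis
  have trig: "trig_stable_identity \<xi> (\<lambda>y. R k (?s y))" for k
    using R(1)[of k] trig_stable_identity_one unfolding P_def by fastforce
  have close: "\<bar>\<psi> (?s y) - R k (?s y)\<bar> < 1 / (real k + 1)" for k y
    by (rule R(2)) auto
  show ?thesis
  proof (rule translation_identity_limit)
    show "continuous_on UNIV (\<lambda>y. R k (?s y))" for k using trig unfolding trig_stable_identity_def by blast
    show "\<bar>R k (?s y)\<bar> \<le> K + 1" for k y
    proof -
      have "1 / (real k + 1) \<le> 1" by simp
      then show ?thesis using close[of y k] K[of "?s y"] by linarith
    qed
    show "translation_identity \<xi> (\<lambda>y. R k (?s y))" for k
    proof -
      have "translation_identity \<xi> (\<lambda>y. R k (?s y) * cos (blinfun_apply 0 y))" using trig unfolding trig_stable_identity_def by blast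
      then show ?thesis by simp
    qed
    show "(\<lambda>k. R k (?s y)) \<longlonglongrightarrow> \<psi> (?s y)" for y
    proof (rule LIM_zero_cancel, rule Lim_null_comparison)
      show "\<forall>\<^sub>F k in sequentially. norm (R k (?s y) - \<psi> (?s y)) \<le> 1 / (real k + 1)"
        using close[of y] by (auto simp: abs_minus_commute intro!: always_eventually less_imp_le)
      show "(\<lambda>k. 1 / (real k + 1)) \<longlonglongrightarrow> 0"
        using LIMSEQ_inverse_real_of_nat by (simp add: inverse_eq_divide add.commute)
    qed
  qed
qed

lemma translation_identity_cylindrical:
  fixes x' :: "nat \<Rightarrow> 'e \<Rightarrow>\<^sub>L real"
  assumes \<phi>: "continuous_on UNIV \<phi>" and K: "\<And>v. \<bar>\<phi> v\<bar> \<le> K"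
  shows "translation_identity \<xi> (\<lambda>y. \<phi> (\<lambda>n. blinfun_apply (x' n) y))"
proof (rule translation_identity_limit)
  define L where "L k = real k + 1" for k
  \<comment> \<open>A triangular wave in each functional, equal to the functional where its absolute value is at most
    \<open>L k * pi / 2\<close>; it makes \<open>\<phi> (w k y)\<close> a continuous function of sines.\<close>
  define w where "w k y n = L k * arcsin (sin (blinfun_apply (x' n) y / L k))" for k y n
  show "translation_identity \<xi> (\<lambda>y. \<phi> (w k y))" for k
  proof -
    have "translation_identity \<xi> (\<lambda>y. (\<lambda>v. \<phi> (\<lambda>n. L k * arcsin (v n))) (\<lambda>n. sin (blinfun_apply ((1 / L k) *\<^sub>R x' n) y)))"
    proof (rule translation_identity_sin_vector)
      show "continuous_on {v. \<forall>n. v n \<in> {-1..1}} (\<lambda>v. \<phi> (\<lambda>n. L k * arcsin (v n)))"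
      proof (rule continuous_on_compose2[OF \<phi> _ subset_UNIV], rule continuous_on_coordinatewise_then_product)
        fix n :: nat
        have "continuous_on {v. \<forall>n. v n \<in> {-1..1}} (\<lambda>v :: nat \<Rightarrow> real. v n)"
          by (rule continuous_on_subset[OF continuous_on_product_coordinates]) simp
        then have "continuous_on {v. \<forall>n. v n \<in> {-1..1}} (\<lambda>v :: nat \<Rightarrow> real. arcsin (v n))"
          by (rule continuous_on_arcsin) simp
        then show "continuous_on {v. \<forall>n. v n \<in> {-1..1}} (\<lambda>v :: nat \<Rightarrow> real. L k * arcsin (v n))"
          by (rule continuous_on_mult_left)
      qed
    qed (rule K)
    then show ?thesis unfolding w_def by (simp add: blinfun.bilinear_simps)
  qed
  show "continuous_on UNIV (\<lambda>y. \<phi> (w k y))" for k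
    unfolding w_def
  proof (rule continuous_on_compose2[OF \<phi> _ subset_UNIV], rule continuous_on_coordinatewise_then_product)
    have "continuous_on UNIV (\<lambda>y. arcsin (sin (blinfun_apply (x' n) y / L k)))" for n
      by (rule continuous_on_arcsin) (auto intro!: continuous_intros simp: L_def)
    then show "continuous_on UNIV (\<lambda>y. L k * arcsin (sin (blinfun_apply (x' n) y / L k)))" for n
      by (rule continuous_on_mult_left)
  qed
  show "\<bar>\<phi> (w k y)\<bar> \<le> K" for k y by (rule K)
  show "(\<lambda>k. \<phi> (w k y)) \<longlonglongrightarrow> \<phi> (\<lambda>n. blinfun_apply (x' n) y)" for y
  proof (rule continuous_on_tendsto_compose[OF \<phi>])
    show "(\<lambda>k. w k y) \<longlonglongrightarrow> (\<lambda>n. blinfun_apply (x' n) y)"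
    proof (rule tendsto_coordinatewise_then_product)
      fix n
      obtain N :: nat where N: "\<bar>blinfun_apply (x' n) y\<bar> \<le> real N" using real_arch_simple by blast
      have "w k y n = blinfun_apply (x' n) y" if "k \<ge> N" for k
      proof -
        have "\<bar>blinfun_apply (x' n) y / L k\<bar> \<le> 1" using N that unfolding L_def by (simp add: field_simps)
        then have "- (pi / 2) \<le> blinfun_apply (x' n) y / L k" "blinfun_apply (x' n) y / L k \<le> pi / 2"
          using pi_gt3 by linarith+
        then have "arcsin (sin (blinfun_apply (x' n) y / L k)) = blinfun_apply (x' n) y / L k"
          by (rule arcsin_sin)
        then show ?thesis unfolding w_def L_def by simp
      qed
      then show "(\<lambda>k. w k y n) \<longlonglongrightarrow> blinfun_apply (x' n) y"
        by (intro tendsto_eventually) (auto simp: eventually_sequentially)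
    qed
  qed auto
qed

text \<open>The translation identity for \<open>F\<close>, differentiated at \<open>r = 0\<close>. It determines the derivative from the
  right only, so the two-sided derivative \<open>D\<close> is taken as given.\<close>

lemma gaussian_integration_by_parts:
  fixes x' :: "nat \<Rightarrow> 'e \<Rightarrow>\<^sub>L real"
  assumes \<phi>: "continuous_on UNIV \<phi>" and K: "\<And>v. \<bar>\<phi> v\<bar> \<le> K"
    and F: "\<And>y. F y = \<phi> (\<lambda>n. blinfun_apply (x' n) y)"
    and D: "((\<lambda>r. LINT y|\<mu>. F (y + r *\<^sub>R Q \<xi>)) has_real_derivative D) (at 0)"
  shows "D = (LINT y|\<mu>. blinfun_apply \<xi> y * F y)"
proof -
  define g where "g u = (LINT y|\<mu>. blinfun_apply \<xi> y * F (y + u *\<^sub>R Q \<xi>))" for u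
  have idF: "translation_identity \<xi> F" using translation_identity_cylindrical[OF \<phi> K] by (simp add: F[abs_def])
  have contF: "continuous_on UNIV F"
    unfolding F[abs_def]
    by (rule continuous_on_compose2[OF \<phi> _ subset_UNIV], rule continuous_on_coordinatewise_then_product)
      (intro continuous_intros)
  have KF: "\<bar>F y\<bar> \<le> K" for y unfolding F by (rule K)
  have bF: "bounded (range F)" unfolding bounded_iff using KF by auto
  note int = bounded_continuous_integrable[OF contF bF]
  have wK: "integrable \<mu> (\<lambda>y. \<bar>blinfun_apply \<xi> y\<bar> * K)"
    by (intro Bochner_Integration.integrable_mult_left integrable_abs functional_integrable1)
  have cont: "continuous_on {0..1} g"
  proof (rule continuous_on_sequentiallyI)
    fix u :: "nat \<Rightarrow> real" and a assume u: "u \<longlonglongrightarrow> a"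
    have "(\<lambda>n. F (y + u n *\<^sub>R Q \<xi>)) \<longlonglongrightarrow> F (y + a *\<^sub>R Q \<xi>)" for y
      by (rule continuous_on_tendsto_compose[OF contF]) (auto intro!: tendsto_intros u)
    then show "(\<lambda>n. g (u n)) \<longlonglongrightarrow> g a"
      unfolding g_def
      by (intro integral_dominated_convergence[where w="\<lambda>y. \<bar>blinfun_apply \<xi> y\<bar> * K"])
        (simp_all add: wK borel_measurable_integrable[OF int(2)] KF functional_integrable1
          tendsto_mult_left abs_mult mult_left_mono)
  qed
  have dI: "((\<lambda>r. integral {0..r} g) has_real_derivative g 0) (at 0 within {0..1})"
    by (rule integral_has_real_derivative[OF cont]) simp
  have eqI: "integral {0..r} g = (LINT y|\<mu>. F (y + r *\<^sub>R Q \<xi>)) - (LINT y|\<mu>. F y)" if "r \<ge> 0" for r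
    using idF that unfolding translation_identity_def g_def by (intro integral_unique) auto
  have "((\<lambda>r. (LINT y|\<mu>. F (y + r *\<^sub>R Q \<xi>)) - (LINT y|\<mu>. F y)) has_real_derivative g 0) (at 0 within {0..1})"
    using dI by (rule has_field_derivative_transform_within[where d=1]) (auto intro: eqI)
  moreover have "((\<lambda>r. (LINT y|\<mu>. F (y + r *\<^sub>R Q \<xi>)) - (LINT y|\<mu>. F y)) has_real_derivative D) (at 0 within {0..1})"
    using DERIV_diff[OF has_field_derivative_at_within[OF D] DERIV_const] by simp
  ultimately have "g 0 = D"
    by (rule has_field_derivative_unique) (simp add: trivial_limit_within islimpt_Icc)
  then show ?thesis unfolding g_def by simp
qed

end

section \<open>Cylindrical functions and the derivative along the Hilbert space\<close>

lemma Cb0_D: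
  assumes "\<psi> \<in> Cb0 N"
  shows "\<And>v w. (\<And>n. n < N \<Longrightarrow> v n = w n) \<Longrightarrow> \<psi> v = \<psi> w"
    and "continuous_on UNIV \<psi>" and "\<exists>K. \<forall>v. \<bar>\<psi> v\<bar> \<le> K"
  using assms unfolding Cb0_def bounded_iff by auto

lemma Cb1_D:
  assumes \<phi>: "\<phi> \<in> Cb 1 N"
  shows "\<phi> \<in> Cb0 N" and "n < N \<Longrightarrow> partial_deriv n \<phi> \<in> Cb0 N"
    and "n < N \<Longrightarrow> ((\<lambda>r. \<phi> (v(n := r))) has_real_derivative partial_deriv n \<phi> (v(n := s))) (at s)"
proof -
  have 1: "\<phi> \<in> Cb0 N" "\<And>n. n < N \<Longrightarrow> partial_deriv n \<phi> \<in> Cb0 N"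
    "\<And>n v. n < N \<Longrightarrow> (\<lambda>r. \<phi> (v(n := r))) field_differentiable at (v n)"
    using \<phi> by auto
  show "\<phi> \<in> Cb0 N" "n < N \<Longrightarrow> partial_deriv n \<phi> \<in> Cb0 N" by (fact 1)+
  assume "n < N"
  from 1(3)[OF this, of "v(n := s)"]
  show "((\<lambda>r. \<phi> (v(n := r))) has_real_derivative partial_deriv n \<phi> (v(n := s))) (at s)"
    unfolding partial_deriv_def by (simp add: DERIV_deriv_iff_field_differentiable)
qed

text \<open>The chain rule along a line for functions with continuous partial derivatives. The increment is
  split into increments in the single coordinates; \<open>u k r\<close> has the first \<open>k\<close> coordinates shifted.\<close>

lemma Cb1_chain_rule:
  assumes \<phi>: "\<phi> \<in> Cb 1 N"
  shows "((\<lambda>r. \<phi> (\<lambda>m. v m + r * w m)) has_real_derivative (\<Sum>n<N. partial_deriv n \<phi> v * w n)) (at 0)"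
proof -
  define u where "u k r = (\<lambda>m. if m < k then v m + r * w m else v m)" for k :: nat and r :: real
  have step: "((\<lambda>r. \<phi> (u (Suc k) r) - \<phi> (u k r)) has_real_derivative partial_deriv k \<phi> v * w k) (at 0)"
    if k: "k < N" for k
  proof -
    have "\<exists>\<theta>. 0 < \<theta> \<and> \<theta> < 1 \<and> \<phi> (u (Suc k) h) - \<phi> (u k h)
        = h * w k * partial_deriv k \<phi> ((u k h)(k := v k + \<theta> * (h * w k)))" for h
    proof -
      define f where "f s = \<phi> ((u k h)(k := v k + s * (h * w k)))" for s
      have "(f has_real_derivative partial_deriv k \<phi> ((u k h)(k := v k + s * (h * w k))) * (h * w k)) (at s)" for s
        unfolding f_def
        by (rule DERIV_chain2[OF Cb1_D(3)[OF \<phi> k]]) (auto intro!: derivative_eq_intros)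
      then have "\<exists>\<theta>>0. \<theta> < 1 \<and> f 1 - f 0 = (1 - 0) * (partial_deriv k \<phi> ((u k h)(k := v k + \<theta> * (h * w k))) * (h * w k))"
        by (intro MVT2) auto
      moreover have "f 1 = \<phi> (u (Suc k) h)" "f 0 = \<phi> (u k h)"
        unfolding f_def u_def by (auto intro!: arg_cong[of _ _ \<phi>])
      ultimately show ?thesis by (auto simp: mult_ac)
    qed
    then obtain \<theta> where \<theta>: "\<And>h. 0 < \<theta> h" "\<And>h. \<theta> h < 1"
      "\<And>h. \<phi> (u (Suc k) h) - \<phi> (u k h) = h * w k * partial_deriv k \<phi> ((u k h)(k := v k + \<theta> h * (h * w k)))"
      by metis
    have lim: "((\<lambda>h. (u k h)(k := v k + \<theta> h * (h * w k))) \<longlongrightarrow> v) (at 0)"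
    proof (rule tendsto_coordinatewise_then_product)
      fix m
      have "((\<lambda>h. \<theta> h * (h * w k)) \<longlongrightarrow> 0) (at 0)"
      proof (rule Lim_null_comparison)
        show "\<forall>\<^sub>F h in at 0. norm (\<theta> h * (h * w k)) \<le> \<bar>h * w k\<bar>"
          using \<theta>(1,2) by (intro always_eventually allI) (simp add: abs_mult mult_left_le_one_le less_imp_le)
        show "((\<lambda>h. \<bar>h * w k\<bar>) \<longlongrightarrow> 0) (at 0)" by (auto intro!: tendsto_eq_intros)
      qed
      then have "((\<lambda>h. v k + \<theta> h * (h * w k)) \<longlongrightarrow> v k) (at 0)"
        using tendsto_add[OF tendsto_const, of _ 0 "at 0" "v k"] by simp
      moreover have "((\<lambda>h. v m + h * w m) \<longlongrightarrow> v m) (at 0)" by (auto intro!: tendsto_eq_intros)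
      ultimately show "((\<lambda>h. ((u k h)(k := v k + \<theta> h * (h * w k))) m) \<longlongrightarrow> v m) (at 0)"
        unfolding u_def by (cases "m = k"; cases "m < k") auto
    qed
    have "((\<lambda>h. partial_deriv k \<phi> ((u k h)(k := v k + \<theta> h * (h * w k))) * w k) \<longlongrightarrow> partial_deriv k \<phi> v * w k) (at 0)"
      by (intro tendsto_mult_right continuous_on_tendsto_compose[OF Cb0_D(2)[OF Cb1_D(2)[OF \<phi> k]] lim]) auto
    moreover have "u (Suc k) 0 = u k 0" unfolding u_def by auto
    ultimately show ?thesis
      unfolding DERIV_def by (rule_tac Lim_transform_eventually) (auto simp: \<theta>(3) eventually_at_filter)
  qed
  have "((\<lambda>r. \<phi> (u k r)) has_real_derivative (\<Sum>n<k. partial_deriv n \<phi> v * w n)) (at 0)" if "k \<le> N" for k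
    using that
  proof (induction k)
    case 0
    then show ?case by (simp add: u_def)
  next
    case (Suc k)
    then show ?case using DERIV_add[OF Suc.IH step[of k]] by simp
  qed
  from this[OF order_refl] show ?thesis
  proof (rule has_field_derivative_transform_within_open[where S=UNIV])
    show "\<phi> (u N r) = \<phi> (\<lambda>m. v m + r * w m)" for r
      by (rule Cb0_D(1)[OF Cb1_D(1)[OF \<phi>]]) (simp add: u_def)
  qed auto
qed

lemma cylindrical_directional_derivative:
  fixes i :: "'h::{real_inner,banach} \<Rightarrow>\<^sub>L 'e::banach"
  assumes "cylindrical_rep 1 N \<phi> x' f"
  shows "((\<lambda>r. f (x + r *\<^sub>R blinfun_apply i h)) has_real_derivative
    inner (\<Sum>n<N. partial_deriv n \<phi> (\<lambda>m. blinfun_apply (x' m) x) *\<^sub>R embedding_adjoint i (x' n)) h) (at 0)"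
proof -
  have \<phi>: "\<phi> \<in> Cb 1 N" and f: "f = (\<lambda>x. \<phi> (\<lambda>n. blinfun_apply (x' n) x))"
    using assms unfolding cylindrical_rep_def by auto
  show ?thesis
    using Cb1_chain_rule[OF \<phi>, of "\<lambda>m. blinfun_apply (x' m) x" "\<lambda>m. blinfun_apply (x' m) (blinfun_apply i h)"]
    unfolding f by (simp add: inner_sum_left inner_embedding_adjoint blinfun.bilinear_simps)
qed

text \<open>Every cylindrical representation of \<open>f\<close> yields the same directional derivatives, so the vector in
  the definition of \<open>D_H\<close> is unique.\<close>

lemma D_H_directional_derivative:
  fixes i :: "'h::{real_inner,banach} \<Rightarrow>\<^sub>L 'e::banach"
  assumes "f \<in> FCb 1"
  shows "((\<lambda>r. f (x + r *\<^sub>R blinfun_apply i h)) has_real_derivative inner (D_H i f x) h) (at 0)"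
proof -
  obtain N \<phi> x' where rep: "cylindrical_rep 1 N \<phi> x' f" using assms unfolding FCb_def by blast
  define d where "d = (\<Sum>n<N. partial_deriv n \<phi> (\<lambda>m. blinfun_apply (x' m) x) *\<^sub>R embedding_adjoint i (x' n))"
  have "D_H i f x = d"
    unfolding D_H_def
  proof (rule the_equality)
    show "\<exists>N \<phi> x'. cylindrical_rep 1 N \<phi> x' f \<and>
      d = (\<Sum>n<N. partial_deriv n \<phi> (\<lambda>m. blinfun_apply (x' m) x) *\<^sub>R embedding_adjoint i (x' n))"
      using rep unfolding d_def by blast
    fix e assume "\<exists>N \<phi> x'. cylindrical_rep 1 N \<phi> x' f \<and>
      e = (\<Sum>n<N. partial_deriv n \<phi> (\<lambda>m. blinfun_apply (x' m) x) *\<^sub>R embedding_adjoint i (x' n))"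
    then have "inner e h = inner d h" for h
      using cylindrical_directional_derivative[of _ _ _ f x i h] rep unfolding d_def
      by (blast intro: DERIV_unique)
    then show "e = d" using vector_eq_rdot[of e d] vector_eq_ldot[of e d] by blast
  qed
  then show ?thesis using cylindrical_directional_derivative[OF rep] unfolding d_def by simp
qed

lemma Cb0_average:
  assumes M: "prob_space M" "sets M = sets borel" and \<psi>: "\<psi> \<in> Cb0 N"
  shows "(\<lambda>v. LINT y|M. \<psi> (\<lambda>n. v n + blinfun_apply (x' n) y)) \<in> Cb0 N"
    and "integrable M (\<lambda>y. \<psi> (\<lambda>n. v n + blinfun_apply (x' n) y))"
proof -
  interpret prob_space M by (rule M)
  obtain K where K: "\<And>v. \<bar>\<psi> v\<bar> \<le> K" using Cb0_D(3)[OF \<psi>] by blast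
  have meas: "(\<lambda>y. \<psi> (\<lambda>n. v n + blinfun_apply (x' n) y)) \<in> borel_measurable M" for v
  proof -
    have "continuous_on UNIV (\<lambda>y. \<psi> (\<lambda>n. v n + blinfun_apply (x' n) y))"
      by (rule continuous_on_compose2[OF Cb0_D(2)[OF \<psi>] _ subset_UNIV], rule continuous_on_coordinatewise_then_product)
        (intro continuous_intros)
    then show ?thesis using borel_measurable_continuous_onI measurable_cong_sets[OF M(2) refl] by blast
  qed
  show int: "integrable M (\<lambda>y. \<psi> (\<lambda>n. v n + blinfun_apply (x' n) y))" for v
    using K by (intro integrable_const_bound[where B=K] meas) auto
  show "(\<lambda>v. LINT y|M. \<psi> (\<lambda>n. v n + blinfun_apply (x' n) y)) \<in> Cb0 N"
    unfolding Cb0_def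
  proof (intro CollectI conjI allI impI)
    fix v w :: "nat \<Rightarrow> real" assume "\<forall>n<N. v n = w n"
    then have "\<psi> (\<lambda>n. v n + blinfun_apply (x' n) y) = \<psi> (\<lambda>n. w n + blinfun_apply (x' n) y)" for y
      by (intro Cb0_D(1)[OF \<psi>]) simp
    then show "(LINT y|M. \<psi> (\<lambda>n. v n + blinfun_apply (x' n) y)) = (LINT y|M. \<psi> (\<lambda>n. w n + blinfun_apply (x' n) y))"
      by simp
  next
    show "continuous_on UNIV (\<lambda>v. LINT y|M. \<psi> (\<lambda>n. v n + blinfun_apply (x' n) y))"
    proof (rule continuous_on_sequentiallyI)
      fix u :: "nat \<Rightarrow> nat \<Rightarrow> real" and a assume u: "u \<longlonglongrightarrow> a"
      have un: "(\<lambda>k. u k n) \<longlonglongrightarrow> a n" for n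
        using continuous_on_tendsto_compose[OF continuous_on_product_coordinates u] by simp
      have "(\<lambda>k. \<psi> (\<lambda>n. u k n + blinfun_apply (x' n) y)) \<longlonglongrightarrow> \<psi> (\<lambda>n. a n + blinfun_apply (x' n) y)" for y
        by (rule continuous_on_tendsto_compose[OF Cb0_D(2)[OF \<psi>]])
          (auto intro!: tendsto_coordinatewise_then_product tendsto_add un)
      then show "(\<lambda>k. LINT y|M. \<psi> (\<lambda>n. u k n + blinfun_apply (x' n) y)) \<longlonglongrightarrow> (LINT y|M. \<psi> (\<lambda>n. a n + blinfun_apply (x' n) y))"
        by (intro integral_dominated_convergence[where w="\<lambda>_. K"]) (simp_all add: meas K)
    qed
    have "\<bar>LINT y|M. \<psi> (\<lambda>n. v n + blinfun_apply (x' n) y)\<bar> \<le> K" for v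
    proof -
      have "\<bar>LINT y|M. \<psi> (\<lambda>n. v n + blinfun_apply (x' n) y)\<bar> \<le> (LINT y|M. \<bar>\<psi> (\<lambda>n. v n + blinfun_apply (x' n) y)\<bar>)"
        by (rule integral_abs_bound)
      also have "\<dots> \<le> (LINT y|M. K)" by (rule integral_mono) (simp_all add: int K)
      also have "\<dots> = K" by (simp add: prob_space)
      finally show ?thesis .
    qed
    then show "bounded (range (\<lambda>v. LINT y|M. \<psi> (\<lambda>n. v n + blinfun_apply (x' n) y)))"
      unfolding bounded_iff by auto
  qed
qed

text \<open>If \<open>\<phi>\<close> represents \<open>f\<close> with the functionals \<open>x' n\<close>, the average below represents \<open>P(t) f\<close> with the
  functionals \<open>x' n\<close> composed with \<open>S(t)\<close>.\<close>

lemma Cb1_average: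
  assumes M: "prob_space M" "sets M = sets borel" and \<phi>: "\<phi> \<in> Cb 1 N"
  shows "(\<lambda>v. LINT y|M. \<phi> (\<lambda>n. v n + blinfun_apply (x' n) y)) \<in> Cb 1 N" (is "?A \<phi> \<in> _")
proof -
  interpret prob_space M by (rule M)
  have der: "((\<lambda>r. ?A \<phi> (v(n := r))) has_real_derivative ?A (partial_deriv n \<phi>) v) (at (v n))"
    if n: "n < N" for n v
  proof -
    obtain K where K: "\<And>v. \<bar>partial_deriv n \<phi> v\<bar> \<le> K" using Cb0_D(3)[OF Cb1_D(2)[OF \<phi> n]] by blast
    have split: "(\<lambda>m. (v(n := r)) m + blinfun_apply (x' m) y)
       = (\<lambda>m. v m + blinfun_apply (x' m) y)(n := r + blinfun_apply (x' n) y)" for r y by auto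
    have "((\<lambda>r. ?A \<phi> (v(n := r))) has_real_derivative
      (LINT y|M. partial_deriv n \<phi> (\<lambda>m. (v(n := v n)) m + blinfun_apply (x' m) y))) (at (v n))"
    proof (rule has_real_derivative_integral[where K="\<lambda>_. K"])
      have "((\<lambda>r. \<phi> (w(n := r + blinfun_apply (x' n) y))) has_real_derivative
        partial_deriv n \<phi> (w(n := r + blinfun_apply (x' n) y)) * 1) (at r)" for w r y
        by (rule DERIV_chain2[OF Cb1_D(3)[OF \<phi> n]]) (auto intro!: derivative_eq_intros)
      then show "((\<lambda>r. \<phi> (\<lambda>m. (v(n := r)) m + blinfun_apply (x' m) y)) has_real_derivative
        partial_deriv n \<phi> (\<lambda>m. (v(n := r)) m + blinfun_apply (x' m) y)) (at r)" for r y
        unfolding split by simp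
      show "integrable M (\<lambda>y. \<phi> (\<lambda>m. (v(n := r)) m + blinfun_apply (x' m) y))" for r
        by (rule Cb0_average(2)[OF M Cb1_D(1)[OF \<phi>]])
      show "(\<lambda>y. partial_deriv n \<phi> (\<lambda>m. (v(n := v n)) m + blinfun_apply (x' m) y)) \<in> borel_measurable M"
        by (rule borel_measurable_integrable, rule Cb0_average(2)[OF M Cb1_D(2)[OF \<phi> n]])
    qed (simp_all add: K)
    then show ?thesis by simp
  qed
  then have pd: "partial_deriv n (?A \<phi>) = ?A (partial_deriv n \<phi>)" if "n < N" for n
    using that unfolding partial_deriv_def[of n "?A \<phi>"] by (intro ext DERIV_imp_deriv) auto
  have "(\<lambda>r. ?A \<phi> (v(n := r))) field_differentiable at (v n)" if "n < N" for n v
    using der[OF that] unfolding field_differentiable_def by blast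
  moreover have "partial_deriv n (?A \<phi>) \<in> Cb0 N" if "n < N" for n
    unfolding pd[OF that] by (rule Cb0_average(1)[OF M Cb1_D(2)[OF \<phi> that]])
  ultimately show ?thesis using Cb0_average(1)[OF M Cb1_D(1)[OF \<phi>]] by simp
qed

lemma OU_in_FCb:
  assumes M: "prob_space (\<mu> t)" "sets (\<mu> t) = sets borel" and f: "f \<in> FCb 1"
  shows "OU S \<mu> t f \<in> FCb 1"
proof -
  obtain N \<phi> x' where rep: "N \<ge> 1" "\<phi> \<in> Cb 1 N" "f = (\<lambda>x. \<phi> (\<lambda>n. blinfun_apply (x' n) x))"
    using f unfolding FCb_def cylindrical_rep_def by blast
  have "cylindrical_rep 1 N (\<lambda>v. LINT y|\<mu> t. \<phi> (\<lambda>n. v n + blinfun_apply (x' n) y)) (\<lambda>n. x' n o\<^sub>L S t) (OU S \<mu> t f)"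
    unfolding cylindrical_rep_def OU_def
    using rep(1) Cb1_average[OF M rep(2), of x'] by (simp add: rep(3) blinfun.bilinear_simps)
  then show ?thesis unfolding FCb_def by blast
qed

section \<open>The gradient estimate\<close>

theorem proposition2p1:
  fixes S :: "real \<Rightarrow> 'e::banach \<Rightarrow>\<^sub>L 'e"
    and S_H :: "real \<Rightarrow> 'h::{real_inner,banach} \<Rightarrow>\<^sub>L 'h"
    and i :: "'h \<Rightarrow>\<^sub>L 'e"
    and \<mu> :: "real \<Rightarrow> 'e measure"
  assumes "C0_semigroup S"
    and "inj (blinfun_apply i)"
    and "I_op_defined S i {0<..}"
    and "gamma_radonifying {0<..} (I_op S i {0<..})"
    and "\<And>t. t \<ge> 0 \<Longrightarrow> gaussian_measure_of {0<..<t} (I_op S i {0<..<t}) (\<mu> t)"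
    and "C0_semigroup S_H"
    and "\<And>t. t \<ge> 0 \<Longrightarrow> S t o\<^sub>L i = i o\<^sub>L S_H t"
  shows "\<forall>p>1. \<exists>C\<ge>0. \<forall>t>0. \<forall>f\<in>FCb 1. \<forall>x.
           sqrt t * norm (D_H i (OU S \<mu> t f) x)
             \<le> C * kappa S_H t * (OU S \<mu> t (\<lambda>y. \<bar>f y\<bar> powr p) x) powr (1 / p)"
proof (intro allI impI)
  fix p :: real assume p: "p > 1"
  define q where "q = p / (p - 1)"
  have q: "q > 1" "1 / p + 1 / q = 1" using p unfolding q_def by (auto simp: field_simps)
  define m where "m = (LINT z|std_normal_distribution. \<bar>z\<bar> powr q)"
  define C where "C = m powr (1 / q)"
  have "sqrt t * norm (D_H i (OU S \<mu> t f) x) \<le> C * kappa S_H t * (OU S \<mu> t (\<lambda>y. \<bar>f y\<bar> powr p) x) powr (1 / p)"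
    if t: "t > 0" and f: "f \<in> FCb 1" for t f x
  proof -
    obtain Q where Q: "is_T_T_adjoint {0<..<t} (I_op S i {0<..<t}) Q" "covariance_operator (\<mu> t) Q"
      and gauss: "centred_gaussian_radon (\<mu> t)"
      using assms(5)[of t] t unfolding gaussian_measure_of_def by auto
    interpret gaussian_space "\<mu> t" Q
      using gauss Q(2) unfolding centred_gaussian_radon_def radon_prob_def
      by (intro gaussian_space.intro gaussian_space_axioms.intro) auto
    define h where "h = D_H i (OU S \<mu> t f) x"
    define v where "v = blinfun_apply (S t) (blinfun_apply i h)"
    define \<kappa> where "\<kappa> = kappa S_H t"
    have \<kappa>0: "\<kappa> \<ge> 0" unfolding \<kappa>_def using kappa_nonneg[OF assms(6)] t by simp
    obtain N \<phi> x' where \<phi>: "\<phi> \<in> Cb 1 N" and f_eq: "f = (\<lambda>x. \<phi> (\<lambda>n. blinfun_apply (x' n) x))"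
      using f unfolding FCb_def cylindrical_rep_def by blast
    have bound: "(blinfun_apply z v)\<^sup>2 \<le> (\<kappa> * norm h)\<^sup>2 / t * blinfun_apply z (Q z)" for z
      unfolding v_def \<kappa>_def by (rule smoothing_direction_bound[OF assms(6,7) t Q(1)])
    \<comment> \<open>On the functionals \<open>x' n\<close> that \<open>f\<close> depends on, \<open>v = S(t) i h\<close> and \<open>Q \<xi>\<close> agree.\<close>
    have "\<exists>z\<in>span (x' ` {..<N}). \<forall>y\<in>x' ` {..<N}. blinfun_apply y (Q z) = blinfun_apply y v"
    proof (rule bilinear_representation_on_finite)
      show "blinfun_apply y (Q z) = blinfun_apply z (Q y)" for y z by (rule covariance_commute)
      show "linear (\<lambda>y. blinfun_apply y (Q z))" "linear (\<lambda>y. blinfun_apply y v)" for z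
        by (auto intro!: linearI simp: blinfun.bilinear_simps)
    qed (use bound variance_nonneg in \<open>simp_all only: finite_imageI finite_lessThan\<close>)
    then obtain \<xi> where \<xi>: "\<xi> \<in> span (x' ` {..<N})" "\<And>n. n < N \<Longrightarrow> blinfun_apply (x' n) (Q \<xi>) = blinfun_apply (x' n) v"
      by auto
    have var: "sqrt (blinfun_apply \<xi> (Q \<xi>)) \<le> \<kappa> * norm h / sqrt t"
    proof -
      have "blinfun_apply z (Q \<xi>) = blinfun_apply z v" if "z \<in> span (x' ` {..<N})" for z
        using that
      proof (induction rule: span_induct)
        case base
        show ?case by (auto simp: subspace_def blinfun.bilinear_simps)
      next
        case (step z)
        then show ?case using \<xi>(2) by auto
      qed
      from this[OF \<xi>(1)] have le: "blinfun_apply \<xi> (Q \<xi>) * blinfun_apply \<xi> (Q \<xi>) \<le> (\<kappa> * norm h)\<^sup>2 / t * blinfun_apply \<xi> (Q \<xi>)"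
        using bound[of \<xi>] by (simp add: power2_eq_square)
      have "blinfun_apply \<xi> (Q \<xi>) \<le> (\<kappa> * norm h)\<^sup>2 / t"
      proof (cases "blinfun_apply \<xi> (Q \<xi>) = 0")
        case False
        then have "0 < blinfun_apply \<xi> (Q \<xi>)" using variance_nonneg[of \<xi>] by simp
        from mult_right_le_imp_le[OF le this] show ?thesis .
      qed (use t in simp)
      then have "sqrt (blinfun_apply \<xi> (Q \<xi>)) \<le> sqrt ((\<kappa> * norm h)\<^sup>2 / t)" by simp
      also have "\<dots> = \<kappa> * norm h / sqrt t" using \<kappa>0 by (simp add: real_sqrt_divide)
      finally show ?thesis .
    qed
    define F where "F y = f (blinfun_apply (S t) x + y)" for y
    define A where "A = (LINT y|\<mu> t. \<bar>F y\<bar> powr p)"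
    obtain K where K: "\<And>v. \<bar>\<phi> v\<bar> \<le> K" using Cb0_D(3)[OF Cb1_D(1)[OF \<phi>]] by blast
    have shift: "continuous_on UNIV (\<lambda>w. \<phi> (\<lambda>n. blinfun_apply (x' n) (blinfun_apply (S t) x) + w n))"
      by (rule continuous_on_compose2[OF Cb0_D(2)[OF Cb1_D(1)[OF \<phi>]] _ subset_UNIV], rule continuous_on_coordinatewise_then_product)
        (intro continuous_intros continuous_on_product_coordinates)
    have F_eq: "F y = \<phi> (\<lambda>n. blinfun_apply (x' n) (blinfun_apply (S t) x) + blinfun_apply (x' n) y)" for y
      unfolding F_def f_eq by (simp add: blinfun.bilinear_simps)
    have "F (y + r *\<^sub>R v) = F (y + r *\<^sub>R Q \<xi>)" for y r
      unfolding F_eq by (rule Cb0_D(1)[OF Cb1_D(1)[OF \<phi>]]) (simp add: blinfun.bilinear_simps \<xi>(2))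
    then have "OU S \<mu> t f (x + r *\<^sub>R blinfun_apply i h) = (LINT y|\<mu> t. F (y + r *\<^sub>R Q \<xi>))" for r
      unfolding OU_def F_def v_def by (simp add: blinfun.bilinear_simps add_ac)
    moreover have "((\<lambda>r. OU S \<mu> t f (x + r *\<^sub>R blinfun_apply i h)) has_real_derivative inner h h) (at 0)"
      unfolding h_def by (rule D_H_directional_derivative[OF OU_in_FCb[where \<mu>=\<mu> and t=t, OF prob_space_axioms sets_borel f]])
    ultimately have "inner h h = (LINT y|\<mu> t. blinfun_apply \<xi> y * F y)"
      using gaussian_integration_by_parts[OF shift K F_eq] by simp
    moreover have "\<bar>LINT y|\<mu> t. F y * blinfun_apply \<xi> y\<bar>
       \<le> A powr (1 / p) * (LINT y|\<mu> t. \<bar>blinfun_apply \<xi> y\<bar> powr q) powr (1 / q)"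
      unfolding A_def
    proof (rule Hoelder_inequality[OF p q])
      have "continuous_on UNIV F"
        unfolding F_eq[abs_def]
        by (rule continuous_on_compose2[OF shift _ subset_UNIV], rule continuous_on_coordinatewise_then_product)
          (intro continuous_intros)
      then show Fm: "F \<in> borel_measurable (\<mu> t)" by (rule continuous_measurable)
      show "integrable (\<mu> t) (\<lambda>y. \<bar>F y\<bar> powr p)"
      proof (rule integrable_const_bound[where B="K powr p"])
        show "AE y in \<mu> t. norm (\<bar>F y\<bar> powr p) \<le> K powr p"
          using K p by (simp add: F_eq powr_mono2)
        show "(\<lambda>y. \<bar>F y\<bar> powr p) \<in> borel_measurable (\<mu> t)" using Fm by measurable
      qed
    qed (use q absolute_moment(1) in auto)
    moreover have "(LINT y|\<mu> t. \<bar>blinfun_apply \<xi> y\<bar> powr q) powr (1 / q) = sqrt (blinfun_apply \<xi> (Q \<xi>)) * C"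
      using q variance_nonneg[of \<xi>] unfolding C_def m_def
      by (subst absolute_moment(2)) (auto simp: powr_mult powr_powr)
    ultimately have "(norm h)\<^sup>2 \<le> A powr (1 / p) * (sqrt (blinfun_apply \<xi> (Q \<xi>)) * C)"
      by (simp add: power2_norm_eq_inner mult.commute)
    also have "\<dots> \<le> A powr (1 / p) * (\<kappa> * norm h / sqrt t * C)"
      using var by (intro mult_left_mono mult_right_mono) (auto simp: C_def)
    finally have key: "(norm h)\<^sup>2 \<le> A powr (1 / p) * (\<kappa> * norm h / sqrt t * C)" .
    have "sqrt t * norm h \<le> C * \<kappa> * A powr (1 / p)"
    proof (cases "h = 0")
      case True
      then show ?thesis using \<kappa>0 by (simp add: C_def)
    next
      case False
      then have "norm h * (sqrt t * norm h) \<le> norm h * (C * \<kappa> * A powr (1 / p))"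
        using key t by (simp add: field_simps power2_eq_square)
      then show ?thesis using False by (simp add: mult_le_cancel_left)
    qed
    then show ?thesis unfolding h_def \<kappa>_def A_def F_def OU_def .
  qed
  moreover have "C \<ge> 0" unfolding C_def by simp
  ultimately show "\<exists>C\<ge>0. \<forall>t>0. \<forall>f\<in>FCb 1. \<forall>x.
           sqrt t * norm (D_H i (OU S \<mu> t f) x)
             \<le> C * kappa S_H t * (OU S \<mu> t (\<lambda>y. \<bar>f y\<bar> powr p) x) powr (1 / p)"
    by blast
qed

end
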